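(* Let $p>1$, $R,T>0$, and let $u\in C^{2,1}(Q_{R,T})$ be a classical solution of $u_t-\Delta u=|\nabla u|^p$ in $Q_{R,T}:=B_R\times(0,T)$ such that $M:=\sup_{Q_{R,T}}u<\infty$. Then there is $C=C(n,p)>0$ such that $$|\nabla u(x,t)|\le C\left\{\frac{M-u(x,t)}{R}+\Big(\frac{M-u(x,t)}{\min(R^2,t)}\Big)^{1/p}\right\}\quad\text{for all }(x,t)\in B_{R/2}\times(0,T).$$
   Context: $B_R:=\{x\in\mathbb{R}^n: |x|<R\}$. *)

theory Defs
  imports "HOL-Analysis.Analysis"
begin

definition partial :: "'n::finite \<Rightarrow> (real^'n \<Rightarrow> real) \<Rightarrow> real^'n \<Rightarrow> real" where
  "partial i f x = deriv (\<lambda>s. f (x + s *\<^sub>R axis i 1)) 0"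

definition grad :: "(real^'n::finite \<Rightarrow> real) \<Rightarrow> real^'n \<Rightarrow> real^'n" where
  "grad f x = (\<chi> i. partial i f x)"

definition laplacian :: "(real^'n::finite \<Rightarrow> real) \<Rightarrow> real^'n \<Rightarrow> real" where
  "laplacian f x = (\<Sum>i\<in>UNIV. partial i (partial i f) x)"

definition dt :: "(real^'n::finite \<Rightarrow> real \<Rightarrow> real) \<Rightarrow> real^'n \<Rightarrow> real \<Rightarrow> real" where
  "dt u x t = deriv (\<lambda>s. u x s) t"

definition C21_on :: "((real^'n::finite) \<times> real) set \<Rightarrow> (real^'n \<Rightarrow> real \<Rightarrow> real) \<Rightarrow> bool" where
  "C21_on Q u \<longleftrightarrow>
     (\<forall>(x,t)\<in>Q.
        (\<forall>i. (\<lambda>s. u (x + s *\<^sub>R axis i 1) t) differentiable (at 0)) \<and>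
        (\<forall>i j. (\<lambda>s. partial j (\<lambda>y. u y t) (x + s *\<^sub>R axis i 1)) differentiable (at 0)) \<and>
        (\<lambda>s. u x s) differentiable (at t)) \<and>
     continuous_on Q (\<lambda>(x,t). u x t) \<and>
     (\<forall>i. continuous_on Q (\<lambda>(x,t). partial i (\<lambda>y. u y t) x)) \<and>
     (\<forall>i j. continuous_on Q (\<lambda>(x,t). partial i (partial j (\<lambda>y. u y t)) x)) \<and>
     continuous_on Q (\<lambda>(x,t). dt u x t)"

end

theory Submission
  imports Defs
begin

text \<open>
  For a constant \<open>M\<close> exceeding \<open>u\<close> on the cylinder, put \<open>v = M - u > 0\<close>, \<open>w = v\<^bsup>(p-1)/p\<^esup>\<close> and \<open>Z = ln (w + L)\<close> with
  \<open>L = R (1/R\<^sup>2 + 1/t0)\<^bsup>1/p\<^esup>\<close>. The claim becomes \<open>|\<nabla>Z| \<le> C/R\<close>. The function \<open>Z\<close> solves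
  \<open>Z\<^sub>t - \<Delta>Z = \<alpha>(Z) |\<nabla>Z|\<^sup>2 - \<beta>(Z) |\<nabla>Z|\<^sup>p\<close> with \<open>\<alpha>\<close> decreasing and \<open>\<beta>\<close> increasing, so that both
  terms help in Bernstein's argument. Since \<open>u\<close> is only \<open>C\<^bsup>2,1\<^esup>\<close>, the equation cannot be differentiated;
  instead the maximum principle is applied to \<open>\<eta> (Z(x + h e, t) - Z(x, t)) / h\<close> with a cutoff \<open>\<eta>\<close>, and
  \<open>h\<close> tends to 0 in the resulting inequality at the maximum points. The constant \<open>M\<close> finally
  decreases to the supremum of \<open>u\<close>.
\<close>

section \<open>Bernstein's inequality via difference quotients\<close>

text \<open>The exponent \<open>c = (p - 1) / p\<close> is chosen for the absorption. With
  \<open>W = w + L\<close>, a general power \<open>w = v powr c\<close> gives a coefficient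
  \<open>\<beta>\<close> proportional to \<open>w powr q * W powr (p - 1)\<close>, where
  \<open>q = (1 - c) * (p - 1) / c\<close>, and its derivative in \<open>Z\<close> contains
  \<open>q * w powr (q - 1) * W powr p\<close>. The choice of \<open>c\<close> means
  \<open>q = 1\<close>: this good term is then \<open>W powr p\<close>, bounded below by
  \<open>L powr p\<close> even where \<open>w\<close> is near 0. The role of \<open>L\<close> is to
  make that lower bound match the cutoff errors: \<open>(L / R) powr p\<close> is the sum of their
  scales, 1/R^2 in space and 1/t0 in time. The coefficient \<open>\<alpha>\<close> does blow up as
  \<open>w\<close> tends to 0, but its derivative is more singular and has the good sign. Only one
  directional derivative of \<open>Z\<close> is maximised at a time, whereas the good terms at the
  maximum contain the full gradient, which dominates it. Working by components therefore costs no
  more than a factor n.\<close>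

lemma local_max_second_derivative:
  fixes f f' :: "real \<Rightarrow> real"
  assumes "\<delta> > 0"
    and f: "\<And>s. \<bar>s\<bar> < \<delta> \<Longrightarrow> (f has_real_derivative f' s) (at s)"
    and f': "(f' has_real_derivative c) (at 0)"
    and max: "\<And>s. \<bar>s\<bar> < \<delta> \<Longrightarrow> f s \<le> f 0"
  shows "f' 0 = 0" and "c \<le> 0"
proof -
  show 0: "f' 0 = 0"
    using DERIV_local_max[OF f[of 0] \<open>\<delta> > 0\<close>] max \<open>\<delta> > 0\<close> by auto
  show "c \<le> 0"
  proof (rule ccontr)
    assume "\<not> c \<le> 0"
    then obtain d where d: "d > 0" "\<And>h. 0 < h \<Longrightarrow> h < d \<Longrightarrow> f' 0 < f' (0 + h)"
      using DERIV_pos_inc_right[OF f'] by force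
    define e where "e = min d \<delta> / 2"
    have e: "e > 0" "e < d" "e < \<delta>" using \<open>d > 0\<close> \<open>\<delta> > 0\<close> by (auto simp: e_def min_def)
    obtain z where "0 < z" "z < e" "f e - f 0 = (e - 0) * f' z"
      using MVT2[of 0 e f f'] f e by force
    moreover from this have "f' z > 0" using d(2)[of z] 0 e by auto
    ultimately show False using max[of e] e by (smt (verit) mult_pos_pos)
  qed
qed

text \<open>Partial derivatives are given at parameter 0 for every base point; moving the base point
  along the line yields the derivative at every parameter.\<close>

lemma DERIV_line:
  fixes x e :: "'a::real_vector"
  assumes "((\<lambda>r. F ((x + s *\<^sub>R e) + r *\<^sub>R e)) has_real_derivative c) (at 0)"
  shows "((\<lambda>r. F (x + r *\<^sub>R e)) has_real_derivative c) (at s)"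
  using DERIV_shift[of "\<lambda>r. F (x + r *\<^sub>R e)" c 0 s] assms
  by (simp add: algebra_simps scaleR_left_distrib)

lemma DERIV_rescale:
  assumes "(f has_real_derivative c) (at (s * \<sigma>))"
  shows "((\<lambda>s. f (s * \<sigma>)) has_real_derivative \<sigma> * c) (at s)"
proof -
  have "((\<lambda>s. s * \<sigma>) has_real_derivative \<sigma>) (at s)"
    by (auto intro!: derivative_eq_intros)
  from DERIV_chain2[OF assms this] show ?thesis by (simp add: mult.commute)
qed

text \<open>The first-order condition determines \<open>D'\<close> at 0. Inserting it into the
  second-order condition turns the cross term \<open>2 * \<eta>' * D'\<close> into the square of the
  logarithmic derivative of \<open>\<eta>\<close>, so that no derivative of \<open>D\<close> is left
  on the right.\<close>

lemma product_local_max: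
  fixes \<eta> D :: "real \<Rightarrow> real"
  assumes "\<delta> > 0"
    and \<eta>: "\<And>s. \<bar>s\<bar> < \<delta> \<Longrightarrow> (\<eta> has_real_derivative \<eta>' s) (at s)"
    and D: "\<And>s. \<bar>s\<bar> < \<delta> \<Longrightarrow> (D has_real_derivative D' s) (at s)"
    and \<eta>': "(\<eta>' has_real_derivative \<eta>'') (at 0)"
    and D': "(D' has_real_derivative D'') (at 0)"
    and max: "\<And>s. \<bar>s\<bar> < \<delta> \<Longrightarrow> \<eta> s * D s \<le> \<eta> 0 * D 0"
    and pos: "\<eta> 0 > 0"
  shows "D' 0 = - (D 0 * \<eta>' 0 / \<eta> 0)"
    and "D'' \<le> D 0 * (2 * (\<eta>' 0)\<^sup>2 / (\<eta> 0)\<^sup>2 - \<eta>'' / \<eta> 0)"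
proof -
  have 1: "((\<lambda>s. \<eta> s * D s) has_real_derivative \<eta>' s * D s + \<eta> s * D' s) (at s)" if "\<bar>s\<bar> < \<delta>" for s
    by (auto intro!: derivative_eq_intros \<eta> D that)
  have 2: "((\<lambda>s. \<eta>' s * D s + \<eta> s * D' s) has_real_derivative
      \<eta>'' * D 0 + 2 * \<eta>' 0 * D' 0 + \<eta> 0 * D'') (at 0)"
    using \<eta>[of 0] D[of 0] \<eta>' D' \<open>\<delta> > 0\<close> by (auto intro!: derivative_eq_intros simp: algebra_simps)
  note lm = local_max_second_derivative[OF \<open>\<delta> > 0\<close> 1 2 max]
  have a: "\<eta>' 0 * D 0 + \<eta> 0 * D' 0 = 0"
    using lm(1) by simp
  have b: "\<eta>'' * D 0 + 2 * \<eta>' 0 * D' 0 + \<eta> 0 * D'' \<le> 0"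
    using lm(2) by simp
  show c: "D' 0 = - (D 0 * \<eta>' 0 / \<eta> 0)" using a pos by (simp add: field_simps)
  have "\<eta> 0 * D'' \<le> - \<eta>'' * D 0 - 2 * \<eta>' 0 * D' 0" using b by simp
  then have "D'' \<le> (- \<eta>'' * D 0 - 2 * \<eta>' 0 * D' 0) / \<eta> 0"
    using pos by (simp add: pos_le_divide_eq mult.commute)
  also have "\<dots> = D 0 * (2 * (\<eta>' 0)\<^sup>2 / (\<eta> 0)\<^sup>2 - \<eta>'' / \<eta> 0)"
    unfolding c using pos by (simp add: field_simps power2_eq_square)
  finally show "D'' \<le> D 0 * (2 * (\<eta>' 0)\<^sup>2 / (\<eta> 0)\<^sup>2 - \<eta>'' / \<eta> 0)" .
qed

text \<open>The cutoff does not vanish at the terminal time, so the maximum over a cylinder may sit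
  there. Comparison with earlier times still gives the sign of the time derivative.\<close>

lemma DERIV_max_at_right_end:
  fixes f :: "real \<Rightarrow> real"
  assumes f: "(f has_real_derivative c) (at b)" and "a < b"
    and max: "\<And>s. a < s \<Longrightarrow> s \<le> b \<Longrightarrow> f s \<le> f b"
  shows "c \<ge> 0"
proof (rule ccontr)
  assume "\<not> c \<ge> 0"
  then obtain d where d: "d > 0" "\<And>h. 0 < h \<Longrightarrow> h < d \<Longrightarrow> f b < f (b - h)"
    using DERIV_neg_dec_left[OF f] by force
  define h where "h = min d (b - a) / 2"
  have "0 < h" "h < d" "h < b - a" using d(1) \<open>a < b\<close> by (auto simp: h_def min_def)
  then show False using d(2)[of h] max[of "b - h"] by auto
qed

lemma norm_vec_power2: "(norm (\<chi> i. f i))\<^sup>2 = (\<Sum>i\<in>UNIV. (f i)\<^sup>2)" for f :: "'n::finite \<Rightarrow> real"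
  unfolding norm_vec_def L2_set_def by (simp add: sum_nonneg)

section \<open>Differences of the gradient nonlinearity\<close>

lemma powr_diff_le:
  fixes x y p :: real
  assumes "0 \<le> x" "x \<le> y" "p > 1"
  shows "y powr p - x powr p \<le> p * y powr (p - 1) * (y - x)"
proof (cases "x = y")
  case False
  then have "x < y" using assms by simp
  have "continuous_on {x..y} (\<lambda>z. z powr p)"
    using assms by (intro continuous_on_powr' continuous_intros) auto
  moreover have "((\<lambda>z. z powr p) has_real_derivative p * z powr (p - 1)) (at z)" if "x < z" for z
    using that assms by (auto intro!: derivative_eq_intros)
  ultimately obtain c where c: "x < c" "c < y" "y powr p - x powr p = p * c powr (p - 1) * (y - x)"
    using mvt[OF \<open>x < y\<close>, of "\<lambda>z. z powr p" "\<lambda>z. (*) (p * z powr (p - 1))"]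
    unfolding has_field_derivative_def by metis
  moreover have "c powr (p - 1) \<le> y powr (p - 1)"
    using c assms by (intro powr_mono2) auto
  ultimately show ?thesis
    using assms by (simp add: mult_left_mono mult_right_mono)
qed simp

text \<open>The difference is split into a change of the coefficients at the fixed gradient size
  \<open>g1\<close>, treated by the mean value theorem separately for \<open>a\<close> and
  \<open>b\<close>, and a change of gradient size at the fixed coefficients \<open>a s0\<close>,
  \<open>b s0\<close>. The assumption on \<open>G\<close> makes the second part proportional to
  \<open>s1 - s0\<close> as well, so that this factor can later be divided out.\<close>

lemma nonlinearity_difference_le:
  fixes s0 s1 g0 g1 G p l :: real and a b a' b' :: "real \<Rightarrow> real"
  assumes a': "\<And>s. l < s \<Longrightarrow> (a has_real_derivative a' s) (at s)"
    and b': "\<And>s. l < s \<Longrightarrow> (b has_real_derivative b' s) (at s)"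
    and nonneg: "a s0 \<ge> 0" "b s0 \<ge> 0" "g0 \<ge> 0" "g1 \<ge> 0"
    and s: "l < s0" "s0 < s1" and p: "p > 1"
    and G: "\<bar>g1 - g0\<bar> \<le> (s1 - s0) * G"
  shows "\<exists>\<sigma>1\<in>{s0..s1}. \<exists>\<sigma>2\<in>{s0..s1}. (a s1 * g1\<^sup>2 - b s1 * g1 powr p) - (a s0 * g0\<^sup>2 - b s0 * g0 powr p)
      \<le> (s1 - s0) * (a' \<sigma>1 * g1\<^sup>2 - b' \<sigma>2 * g1 powr p
          + (a s0 * (g0 + g1) + p * b s0 * max g0 g1 powr (p - 1)) * G)"
proof -
  obtain \<sigma>1 where \<sigma>1: "s0 < \<sigma>1" "\<sigma>1 < s1" "a s1 - a s0 = (s1 - s0) * a' \<sigma>1"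
    using MVT2[OF s(2), of a a'] a' s by force
  obtain \<sigma>2 where \<sigma>2: "s0 < \<sigma>2" "\<sigma>2 < s1" "b s1 - b s0 = (s1 - s0) * b' \<sigma>2"
    using MVT2[OF s(2), of b b'] b' s by force
  have "g1\<^sup>2 - g0\<^sup>2 = (g0 + g1) * (g1 - g0)" by (simp add: power2_eq_square algebra_simps)
  also have "\<dots> \<le> (g0 + g1) * ((s1 - s0) * G)"
    using G nonneg by (intro mult_left_mono) auto
  finally have A: "a s0 * (g1\<^sup>2 - g0\<^sup>2) \<le> a s0 * ((g0 + g1) * ((s1 - s0) * G))"
    using nonneg by (intro mult_left_mono) auto
  have "g0 powr p - g1 powr p \<le> p * max g0 g1 powr (p - 1) * \<bar>g1 - g0\<bar>"
  proof (cases "g1 \<le> g0")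
    case True
    then show ?thesis using powr_diff_le[of g1 g0 p] nonneg p by (simp add: max_def)
  next
    case False
    then have "g0 powr p \<le> g1 powr p" using nonneg p by (intro powr_mono2) auto
    moreover have "0 \<le> p * max g0 g1 powr (p - 1) * \<bar>g1 - g0\<bar>" using p by simp
    ultimately show ?thesis by linarith
  qed
  also have "\<dots> \<le> p * max g0 g1 powr (p - 1) * ((s1 - s0) * G)"
    using G p by (intro mult_left_mono) auto
  finally have B: "b s0 * (g0 powr p - g1 powr p) \<le> b s0 * (p * max g0 g1 powr (p - 1) * ((s1 - s0) * G))"
    using nonneg by (intro mult_left_mono) auto
  have "(a s1 * g1\<^sup>2 - b s1 * g1 powr p) - (a s0 * g0\<^sup>2 - b s0 * g0 powr p)
      = (a s1 - a s0) * g1\<^sup>2 - (b s1 - b s0) * g1 powr p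
        + a s0 * (g1\<^sup>2 - g0\<^sup>2) + b s0 * (g0 powr p - g1 powr p)"
    by (simp add: algebra_simps)
  also have "\<dots> \<le> (s1 - s0) * a' \<sigma>1 * g1\<^sup>2 - (s1 - s0) * b' \<sigma>2 * g1 powr p
        + a s0 * ((g0 + g1) * ((s1 - s0) * G)) + b s0 * (p * max g0 g1 powr (p - 1) * ((s1 - s0) * G))"
    using A B unfolding \<sigma>1(3) \<sigma>2(3) by linarith
  finally show ?thesis
    by (intro bexI[of _ \<sigma>1] bexI[of _ \<sigma>2]) (use \<sigma>1 \<sigma>2 in \<open>auto simp: algebra_simps\<close>)
qed

section \<open>The maximum principle for translates of a solution, in an abstract setting\<close>

text \<open>The comparison argument is separated from the explicit formulas for \<open>Z\<close>,
  the coefficients and the cutoff. The closed cylinder of radius \<open>r\<close> over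
  \<open>{\<tau>..t0}\<close> is compact inside the open one, with a margin \<open>R - r\<close> for
  translations. The signs of \<open>a'\<close> and \<open>b'\<close> enter later, when the resulting
  inequality is absorbed.\<close>

locale local_gradient_equation =
  fixes R T p :: real
    and Z Zt :: "real^'n::finite \<Rightarrow> real \<Rightarrow> real" and Zi Zii :: "'n \<Rightarrow> real^'n \<Rightarrow> real \<Rightarrow> real"
    and a b a' b' :: "real \<Rightarrow> real" and l :: real
    and r \<tau> t0 :: real
    and \<eta> \<eta>t :: "real^'n \<Rightarrow> real \<Rightarrow> real" and \<eta>i \<eta>ii :: "'n \<Rightarrow> real^'n \<Rightarrow> real \<Rightarrow> real"
  assumes p: "p > 1" and r: "0 < r" "r < R" and times: "0 < \<tau>" "\<tau> < t0" "t0 < T"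
    and Z_cont: "continuous_on (ball 0 R \<times> {0<..<T}) (\<lambda>(x, t). Z x t)"
    and Zi_cont: "\<And>i. continuous_on (ball 0 R \<times> {0<..<T}) (\<lambda>(x, t). Zi i x t)"
    and Zi: "\<And>i x t. x \<in> ball 0 R \<Longrightarrow> t \<in> {0<..<T} \<Longrightarrow>
        ((\<lambda>s. Z (x + s *\<^sub>R axis i 1) t) has_real_derivative Zi i x t) (at 0)"
    and Zii: "\<And>i x t. x \<in> ball 0 R \<Longrightarrow> t \<in> {0<..<T} \<Longrightarrow>
        ((\<lambda>s. Zi i (x + s *\<^sub>R axis i 1) t) has_real_derivative Zii i x t) (at 0)"
    and Zt: "\<And>x t. x \<in> ball 0 R \<Longrightarrow> t \<in> {0<..<T} \<Longrightarrow>
        ((\<lambda>s. Z x s) has_real_derivative Zt x t) (at t)"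
    and Z_range: "\<And>x t. x \<in> ball 0 R \<Longrightarrow> t \<in> {0<..<T} \<Longrightarrow> l < Z x t"
    and a': "\<And>s. l < s \<Longrightarrow> (a has_real_derivative a' s) (at s)" "\<And>s. l < s \<Longrightarrow> isCont a' s"
    and b': "\<And>s. l < s \<Longrightarrow> (b has_real_derivative b' s) (at s)" "\<And>s. l < s \<Longrightarrow> isCont b' s"
    and ab_nonneg: "\<And>s. l < s \<Longrightarrow> a s \<ge> 0" "\<And>s. l < s \<Longrightarrow> b s \<ge> 0"
    and equation: "\<And>x t. x \<in> ball 0 R \<Longrightarrow> t \<in> {0<..<T} \<Longrightarrow>
        Zt x t - (\<Sum>i\<in>UNIV. Zii i x t)
          = a (Z x t) * (norm (\<chi> i. Zi i x t))\<^sup>2 - b (Z x t) * norm (\<chi> i. Zi i x t) powr p"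
    and \<eta>i: "\<And>i x t. ((\<lambda>s. \<eta> (x + s *\<^sub>R axis i 1) t) has_real_derivative \<eta>i i x t) (at 0)"
    and \<eta>ii: "\<And>i x t. ((\<lambda>s. \<eta>i i (x + s *\<^sub>R axis i 1) t) has_real_derivative \<eta>ii i x t) (at 0)"
    and \<eta>t: "\<And>x t. ((\<lambda>s. \<eta> x s) has_real_derivative \<eta>t x t) (at t)"
    and \<eta>_cont: "continuous_on UNIV (\<lambda>(x, t). \<eta> x t)" "\<And>i. continuous_on UNIV (\<lambda>(x, t). \<eta>i i x t)"
      "\<And>i. continuous_on UNIV (\<lambda>(x, t). \<eta>ii i x t)" "continuous_on UNIV (\<lambda>(x, t). \<eta>t x t)"
    and \<eta>_nonneg: "\<And>x t. x \<in> cball 0 r \<Longrightarrow> t \<in> {\<tau>..t0} \<Longrightarrow> \<eta> x t \<ge> 0"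
    and \<eta>_boundary: "\<And>x t. norm x = r \<or> t = \<tau> \<Longrightarrow> \<eta> x t = 0"
begin

text \<open>At an interior maximum of \<open>\<eta> * D\<close> the gradient of \<open>D\<close>
  equals -D times the logarithmic gradient of \<open>\<eta>\<close>, which controls the change of
  gradient between \<open>x\<close> and \<open>x + e\<close>. Summing the second-order conditions
  over the axes and adding the time condition bounds the heat operator of \<open>D\<close> from
  below, and this operator is the difference of the one for \<open>Z\<close> at the two
  points.\<close>

lemma difference_max_principle:
  assumes e: "norm e + r < R"
    and x: "x \<in> ball 0 r" and t: "\<tau> < t" "t \<le> t0"
    and D_def: "\<And>x t. D x t = Z (x + e) t - Z x t"
    and max: "\<And>y s. y \<in> cball 0 r \<Longrightarrow> s \<in> {\<tau>..t0} \<Longrightarrow> \<eta> y s * D y s \<le> \<eta> x t * D x t"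
    and pos: "\<eta> x t > 0"
  shows "norm ((\<chi> i. Zi i (x + e) t) - (\<chi> i. Zi i x t)) = \<bar>D x t\<bar> * norm (\<chi> i. \<eta>i i x t) / \<eta> x t" (is ?A)
    and "D x t * ((\<Sum>i\<in>UNIV. \<eta>ii i x t) / \<eta> x t - \<eta>t x t / \<eta> x t
           - 2 * (norm (\<chi> i. \<eta>i i x t))\<^sup>2 / (\<eta> x t)\<^sup>2)
         \<le> (Zt (x + e) t - (\<Sum>i\<in>UNIV. Zii i (x + e) t)) - (Zt x t - (\<Sum>i\<in>UNIV. Zii i x t))" (is ?B)
proof -
  define \<delta> where "\<delta> = r - norm x"
  have \<delta>: "\<delta> > 0" using x by (simp add: \<delta>_def)
  have tT: "t \<in> {0<..<T}" using t times by auto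
  have in_r: "x + s *\<^sub>R axis i 1 \<in> ball 0 r" if "\<bar>s\<bar> < \<delta>" for s and i :: 'n
    using norm_triangle_ineq[of x "s *\<^sub>R axis i 1"] that by (simp add: \<delta>_def)
  have in_R: "y \<in> ball 0 R \<and> y + e \<in> ball 0 R" if "y \<in> ball 0 r" for y
    using norm_triangle_ineq[of y e] that e norm_ge_zero[of e] by (simp, linarith)
  have DZ: "((\<lambda>s. D (x + s *\<^sub>R axis i 1) t) has_real_derivative
       Zi i (x + e + s *\<^sub>R axis i 1) t - Zi i (x + s *\<^sub>R axis i 1) t) (at s)" if "\<bar>s\<bar> < \<delta>" for i s
  proof -
    have eq: "x + s *\<^sub>R axis i 1 + e = x + e + s *\<^sub>R axis i 1" for s by (simp add: algebra_simps)
    have "((\<lambda>s. Z (x + e + s *\<^sub>R axis i 1) t) has_real_derivative Zi i (x + e + s *\<^sub>R axis i 1) t) (at s)"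
      by (rule DERIV_line[of "\<lambda>x. Z x t"])
        (rule Zi[OF _ tT], use in_R[OF in_r[OF that, of i]] in \<open>simp only: eq\<close>)
    moreover have "((\<lambda>s. Z (x + s *\<^sub>R axis i 1) t) has_real_derivative Zi i (x + s *\<^sub>R axis i 1) t) (at s)"
      by (rule DERIV_line[of "\<lambda>x. Z x t"]) (rule Zi[OF _ tT], use in_R[OF in_r[OF that, of i]] in simp)
    ultimately show ?thesis unfolding D_def eq by (rule DERIV_diff)
  qed
  have DZZ: "((\<lambda>s. Zi i (x + e + s *\<^sub>R axis i 1) t - Zi i (x + s *\<^sub>R axis i 1) t) has_real_derivative
       Zii i (x + e) t - Zii i x t) (at 0)" for i
    using Zii[of "x + e" t i] Zii[of x t i] in_R[OF x] tT by (intro DERIV_diff) auto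
  have \<eta>_line: "((\<lambda>s. \<eta> (x + s *\<^sub>R axis i 1) t) has_real_derivative \<eta>i i (x + s *\<^sub>R axis i 1) t) (at s)" for i s
    by (rule DERIV_line[of "\<lambda>x. \<eta> x t"]) (rule \<eta>i)
  have max_line: "\<eta> (x + s *\<^sub>R axis i 1) t * D (x + s *\<^sub>R axis i 1) t
      \<le> \<eta> (x + 0 *\<^sub>R axis i 1) t * D (x + 0 *\<^sub>R axis i 1) t" if "\<bar>s\<bar> < \<delta>" for i s
    using max[of "x + s *\<^sub>R axis i 1" t] in_r[OF that, of i] t by simp
  note pm = product_local_max[OF \<delta> \<eta>_line DZ \<eta>ii DZZ max_line, simplified, OF pos]
  have g: "Zi i (x + e) t - Zi i x t = - (D x t * \<eta>i i x t / \<eta> x t)" for i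
    by (rule pm(1))
  have l: "Zii i (x + e) t - Zii i x t \<le> D x t * (2 * (\<eta>i i x t)\<^sup>2 / (\<eta> x t)\<^sup>2 - \<eta>ii i x t / \<eta> x t)" for i
    by (rule pm(2))
  have "(\<chi> i. Zi i (x + e) t) - (\<chi> i. Zi i x t) = (- (D x t / \<eta> x t)) *\<^sub>R (\<chi> i. \<eta>i i x t)"
    by (simp add: vec_eq_iff g)
  then show ?A using pos by (simp add: abs_mult)
  have L: "(\<Sum>i\<in>UNIV. Zii i (x + e) t) - (\<Sum>i\<in>UNIV. Zii i x t)
      \<le> D x t * (2 * (norm (\<chi> i. \<eta>i i x t))\<^sup>2 / (\<eta> x t)\<^sup>2 - (\<Sum>i\<in>UNIV. \<eta>ii i x t) / \<eta> x t)"
  proof -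
    have "(\<Sum>i\<in>UNIV. Zii i (x + e) t) - (\<Sum>i\<in>UNIV. Zii i x t) = (\<Sum>i\<in>UNIV. Zii i (x + e) t - Zii i x t)"
      by (simp add: sum_subtractf)
    also have "\<dots> \<le> (\<Sum>i\<in>UNIV. D x t * (2 * (\<eta>i i x t)\<^sup>2 / (\<eta> x t)\<^sup>2 - \<eta>ii i x t / \<eta> x t))"
      by (rule sum_mono) (rule l)
    also have "\<dots> = D x t * (2 * (norm (\<chi> i. \<eta>i i x t))\<^sup>2 / (\<eta> x t)\<^sup>2 - (\<Sum>i\<in>UNIV. \<eta>ii i x t) / \<eta> x t)"
      by (simp add: norm_vec_power2 sum_distrib_left sum_divide_distrib sum_subtractf right_diff_distrib)
    finally show ?thesis .
  qed
  have Dt: "((\<lambda>s. D x s) has_real_derivative Zt (x + e) t - Zt x t) (at t)"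
    unfolding D_def using Zt[of "x + e" t] Zt[of x t] in_R[OF x] tT by (intro DERIV_diff) auto
  have "((\<lambda>s. \<eta> x s * D x s) has_real_derivative \<eta>t x t * D x t + \<eta> x t * (Zt (x + e) t - Zt x t)) (at t)"
    by (auto intro!: derivative_eq_intros \<eta>t Dt)
  then have "\<eta>t x t * D x t + \<eta> x t * (Zt (x + e) t - Zt x t) \<ge> 0"
    by (rule DERIV_max_at_right_end[where a = \<tau>]) (use t x max[of x] in auto)
  then have "- (D x t * \<eta>t x t / \<eta> x t) \<le> Zt (x + e) t - Zt x t"
    using pos by (simp add: field_simps)
  with L show ?B by (simp add: algebra_simps)
qed

definition "grad_norm x t = norm (\<chi> i. Zi i x t)"
definition "eta_grad_norm x t = norm (\<chi> i. \<eta>i i x t)"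

text \<open>The point \<open>(xh, th)\<close> makes the maximum of \<open>\<eta> * D\<close>
  positive, hence the maximum avoids the zero set of \<open>\<eta>\<close> and both factors are
  positive there. The intermediate points \<open>\<sigma>1\<close>, \<open>\<sigma>2\<close>,
  \<open>z\<close> are recorded because all of them are squeezed to a limit when \<open>h\<close>
  tends to 0.\<close>

lemma difference_estimate:
  assumes h: "0 < h" "h < R - r" and \<sigma>: "\<bar>\<sigma>\<bar> = 1" and "N > 0"
    and e: "e = (h * \<sigma>) *\<^sub>R axis j 1"
    and hat: "xh \<in> cball 0 r" "th \<in> {\<tau>..t0}" "h * N \<le> \<eta> xh th * (Z (xh + e) th - Z xh th)"
  shows "\<exists>x t \<sigma>1 \<sigma>2 z. x \<in> cball 0 r \<and> t \<in> {\<tau>..t0} \<and> \<eta> x t > 0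
      \<and> \<sigma>1 \<in> {Z x t..Z (x + e) t} \<and> \<sigma>2 \<in> {Z x t..Z (x + e) t} \<and> z \<in> {0..h}
      \<and> N \<le> \<eta> x t * (\<sigma> * Zi j (x + (z * \<sigma>) *\<^sub>R axis j 1) t)
      \<and> (\<Sum>i\<in>UNIV. \<eta>ii i x t) / \<eta> x t - \<eta>t x t / \<eta> x t - 2 * (eta_grad_norm x t)\<^sup>2 / (\<eta> x t)\<^sup>2
         \<le> a' \<sigma>1 * (grad_norm (x + e) t)\<^sup>2 - b' \<sigma>2 * grad_norm (x + e) t powr p
          + (a (Z x t) * (grad_norm x t + grad_norm (x + e) t)
            + p * b (Z x t) * max (grad_norm x t) (grad_norm (x + e) t) powr (p - 1))
              * (eta_grad_norm x t / \<eta> x t)"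
proof -
  define D where "D x t = Z (x + e) t - Z x t" for x t
  have ne: "norm e = h" using h \<sigma> by (simp add: e abs_mult)
  have in_R: "y \<in> ball 0 R" "y + e \<in> ball 0 R" if "y \<in> cball 0 r" for y
    using norm_triangle_ineq[of y e] that h ne unfolding mem_ball_0 mem_cball_0 by linarith+
  have tT: "t \<in> {0<..<T}" if "t \<in> {\<tau>..t0}" for t using that times by auto
  let ?K = "cball (0::real^'n) r \<times> {\<tau>..t0}"
  have "continuous_on ?K (\<lambda>q. \<eta> (fst q) (snd q) * D (fst q) (snd q))"
  proof -
    have 1: "continuous_on ?K (\<lambda>q. \<eta> (fst q) (snd q))"
      using continuous_on_subset[OF \<eta>_cont(1)] by (simp add: case_prod_beta)
    have 2: "continuous_on ?K (\<lambda>q. Z (fst q) (snd q))"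
      using continuous_on_subset[OF Z_cont Sigma_mono] in_R(1) tT by (simp add: case_prod_beta subset_iff)
    have "continuous_on ?K ((\<lambda>q. Z (fst q) (snd q)) \<circ> (\<lambda>q. (fst q + e, snd q)))"
    proof (intro continuous_on_compose continuous_intros)
      have "(\<lambda>q. (fst q + e, snd q)) ` ?K \<subseteq> ball 0 R \<times> {0<..<T}"
        using in_R(2) tT by (auto simp: image_subset_iff simp del: mem_ball)
      then show "continuous_on ((\<lambda>q. (fst q + e, snd q)) ` ?K) (\<lambda>q. Z (fst q) (snd q))"
        using continuous_on_subset[OF Z_cont] by (simp add: case_prod_beta)
    qed
    then show ?thesis unfolding D_def using 1 2 by (auto simp: o_def intro!: continuous_intros)
  qed
  moreover have "compact ?K" by (intro compact_Times compact_cball compact_Icc)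
  moreover have "?K \<noteq> {}" using hat(1,2) by (metis SigmaI empty_iff)
  ultimately obtain q where q: "q \<in> ?K"
      "\<forall>q'\<in>?K. \<eta> (fst q') (snd q') * D (fst q') (snd q') \<le> \<eta> (fst q) (snd q) * D (fst q) (snd q)"
    using continuous_attains_sup[of ?K "\<lambda>q. \<eta> (fst q) (snd q) * D (fst q) (snd q)"] by blast
  define x t where "x = fst q" and "t = snd q"
  have x: "x \<in> cball 0 r" and t: "t \<in> {\<tau>..t0}"
    and max: "\<And>y s. y \<in> cball 0 r \<Longrightarrow> s \<in> {\<tau>..t0} \<Longrightarrow> \<eta> y s * D y s \<le> \<eta> x t * D x t"
    using q(1) q(2)[rule_format, of "(_, _)"] by (auto simp: x_def t_def mem_Times_iff)
  have N: "h * N \<le> \<eta> x t * D x t" using max[OF hat(1,2)] hat(3) by (simp add: D_def)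
  then have "\<eta> x t * D x t > 0" using h \<open>N > 0\<close> by (smt (verit) mult_pos_pos)
  then have pos: "\<eta> x t > 0" "D x t > 0"
    using \<eta>_nonneg[OF x t] by (auto simp: zero_less_mult_iff)
  have x': "x \<in> ball 0 r" and t': "\<tau> < t" "t \<le> t0"
    using \<eta>_boundary[of x t] pos(1) x t by (auto simp: less_le)
  have "norm e + r < R" using ne h by simp
  note mp = difference_max_principle[OF this x' t' D_def max pos(1)]
  have "\<bar>grad_norm (x + e) t - grad_norm x t\<bar> \<le> D x t * (eta_grad_norm x t / \<eta> x t)"
    unfolding grad_norm_def eta_grad_norm_def
    by (rule order_trans[OF norm_triangle_ineq3]) (use mp(1) pos in simp)
  then have Gd: "\<bar>grad_norm (x + e) t - grad_norm x t\<bar> \<le> (Z (x + e) t - Z x t) * (eta_grad_norm x t / \<eta> x t)"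
    by (simp add: D_def)
  have l: "l < Z x t" using Z_range[OF in_R(1)[OF x] tT[OF t]] .
  have "Z x t < Z (x + e) t" using pos by (simp add: D_def)
  note nonlinearity_difference_le[OF a'(1) b'(1) ab_nonneg(1)[OF l] ab_nonneg(2)[OF l] _ _ l this p Gd]
  then obtain \<sigma>1 \<sigma>2 where \<sigma>12: "\<sigma>1 \<in> {Z x t..Z (x + e) t}" "\<sigma>2 \<in> {Z x t..Z (x + e) t}"
    and le: "(a (Z (x + e) t) * (grad_norm (x + e) t)\<^sup>2 - b (Z (x + e) t) * grad_norm (x + e) t powr p)
        - (a (Z x t) * (grad_norm x t)\<^sup>2 - b (Z x t) * grad_norm x t powr p)
      \<le> (Z (x + e) t - Z x t) * (a' \<sigma>1 * (grad_norm (x + e) t)\<^sup>2 - b' \<sigma>2 * grad_norm (x + e) t powr p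
          + (a (Z x t) * (grad_norm x t + grad_norm (x + e) t)
            + p * b (Z x t) * max (grad_norm x t) (grad_norm (x + e) t) powr (p - 1))
              * (eta_grad_norm x t / \<eta> x t))"
    unfolding grad_norm_def by (meson norm_ge_zero)
  have "D x t * ((\<Sum>i\<in>UNIV. \<eta>ii i x t) / \<eta> x t - \<eta>t x t / \<eta> x t
           - 2 * (eta_grad_norm x t)\<^sup>2 / (\<eta> x t)\<^sup>2) \<le> D x t * (a' \<sigma>1 * (grad_norm (x + e) t)\<^sup>2 - b' \<sigma>2 * grad_norm (x + e) t powr p
          + (a (Z x t) * (grad_norm x t + grad_norm (x + e) t)
            + p * b (Z x t) * max (grad_norm x t) (grad_norm (x + e) t) powr (p - 1))
              * (eta_grad_norm x t / \<eta> x t))"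
    using order_trans[OF mp(2)] le equation in_R[OF x] tT[OF t]
    by (simp add: grad_norm_def eta_grad_norm_def D_def)
  \<comment> \<open>Dividing by \<open>D x t\<close>, which is of order \<open>h\<close>, leaves an
    inequality that is not trivial in the limit.\<close>
  then have main: "(\<Sum>i\<in>UNIV. \<eta>ii i x t) / \<eta> x t - \<eta>t x t / \<eta> x t
           - 2 * (eta_grad_norm x t)\<^sup>2 / (\<eta> x t)\<^sup>2 \<le> a' \<sigma>1 * (grad_norm (x + e) t)\<^sup>2 - b' \<sigma>2 * grad_norm (x + e) t powr p
          + (a (Z x t) * (grad_norm x t + grad_norm (x + e) t)
            + p * b (Z x t) * max (grad_norm x t) (grad_norm (x + e) t) powr (p - 1))
              * (eta_grad_norm x t / \<eta> x t)"
    using pos by (simp only: mult_le_cancel_left_pos)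
  have deriv: "((\<lambda>s. Z (x + (s * \<sigma>) *\<^sub>R axis j 1) t) has_real_derivative
      \<sigma> * Zi j (x + (s * \<sigma>) *\<^sub>R axis j 1) t) (at s)" if "0 \<le> s" "s \<le> h" for s
  proof -
    have "norm ((s * \<sigma>) *\<^sub>R axis j (1::real)) \<le> h" using that \<sigma> by (simp add: abs_mult)
    then have "x + (s * \<sigma>) *\<^sub>R axis j 1 \<in> ball 0 R"
      using norm_triangle_ineq[of x "(s * \<sigma>) *\<^sub>R axis j 1"] x h(2) unfolding mem_ball_0 mem_cball_0 by linarith
    then have "((\<lambda>s. Z (x + s *\<^sub>R axis j 1) t) has_real_derivative Zi j (x + (s * \<sigma>) *\<^sub>R axis j 1) t) (at (s * \<sigma>))"
      by (rule DERIV_line[of "\<lambda>x. Z x t", OF Zi[OF _ tT[OF t]]])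
    then show ?thesis by (rule DERIV_rescale)
  qed
  \<comment> \<open>The mean value theorem turns the lower bound for the difference quotient into
    one for \<open>Zi j\<close> at a nearby point, to which continuity applies.\<close>
  obtain z where z: "0 < z" "z < h" "Z (x + (h * \<sigma>) *\<^sub>R axis j 1) t - Z (x + (0 * \<sigma>) *\<^sub>R axis j 1) t
      = (h - 0) * (\<sigma> * Zi j (x + (z * \<sigma>) *\<^sub>R axis j 1) t)"
    using MVT2[OF h(1) deriv] by metis
  then have "D x t = h * (\<sigma> * Zi j (x + (z * \<sigma>) *\<^sub>R axis j 1) t)" by (simp add: D_def e)
  then have "h * N \<le> h * (\<eta> x t * (\<sigma> * Zi j (x + (z * \<sigma>) *\<^sub>R axis j 1) t))"
    using N by (metis mult.left_commute)
  then have "N \<le> \<eta> x t * (\<sigma> * Zi j (x + (z * \<sigma>) *\<^sub>R axis j 1) t)"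
    using h by (simp only: mult_le_cancel_left_pos)
  moreover have "z \<in> {0..h}" using z(1,2) by simp
  ultimately show ?thesis using x t pos(1) \<sigma>12 main by blast
qed


text \<open>Letting \<open>h\<close> tend to 0 along a convergent subsequence of maximum points gives what the classical
  Bernstein computation yields at a maximum of \<open>\<eta>\<close> times a directional derivative, had one been
  allowed to differentiate the equation.\<close>

lemma bernstein_inequality:
  assumes "0 < N" and \<sigma>: "\<bar>\<sigma>\<bar> = 1"
    and hat: "xh \<in> cball 0 r" "th \<in> {\<tau>..t0}" "N < \<eta> xh th * (\<sigma> * Zi j xh th)"
  shows "\<exists>x\<in>ball 0 r. \<exists>t\<in>{\<tau><..t0}. \<eta> x t > 0 \<and> N \<le> \<eta> x t * (\<sigma> * Zi j x t)
      \<and> (\<Sum>i\<in>UNIV. \<eta>ii i x t) / \<eta> x t - \<eta>t x t / \<eta> x t - 2 * (eta_grad_norm x t)\<^sup>2 / (\<eta> x t)\<^sup>2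
         \<le> a' (Z x t) * (grad_norm x t)\<^sup>2 - b' (Z x t) * grad_norm x t powr p
          + (2 * a (Z x t) * grad_norm x t + p * b (Z x t) * grad_norm x t powr (p - 1))
              * (eta_grad_norm x t / \<eta> x t)"
proof -
  define e where "e h = (h * \<sigma>) *\<^sub>R axis j (1::real)" for h
  have "xh \<in> ball 0 R" and "th \<in> {0<..<T}" using hat r times by auto
  then have "((\<lambda>s. Z (xh + e s) th) has_real_derivative \<sigma> * Zi j xh th) (at 0)"
    unfolding e_def
    by (intro DERIV_rescale[of "\<lambda>s. Z (xh + s *\<^sub>R axis j 1) th"]) (simp add: Zi)
  then have "((\<lambda>h. (Z (xh + e h) th - Z xh th) / h) \<longlongrightarrow> \<sigma> * Zi j xh th) (at 0)"
    by (simp add: DERIV_def e_def)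
  then have "((\<lambda>h. \<eta> xh th * ((Z (xh + e h) th - Z xh th) / h)) \<longlongrightarrow> \<eta> xh th * (\<sigma> * Zi j xh th)) (at 0)"
    by (intro tendsto_intros)
  \<comment> \<open>The strict inequality at \<open>(xh, th)\<close> is inherited by difference
    quotients with small \<open>h\<close>.\<close>
  then have "eventually (\<lambda>h. N < \<eta> xh th * ((Z (xh + e h) th - Z xh th) / h)) (at 0)"
    using hat(3) by (rule order_tendstoD)
  then obtain d where d: "d > 0"
      "\<And>h. h \<noteq> 0 \<Longrightarrow> \<bar>h\<bar> < d \<Longrightarrow> N < \<eta> xh th * ((Z (xh + e h) th - Z xh th) / h)"
    by (auto simp: eventually_at dist_real_def)
  \<comment> \<open>The denominator starts at 2, so that already \<open>h 0\<close> is strictly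
    below both \<open>d\<close> and \<open>R - r\<close>.\<close>
  define h where "h k = min d (R - r) / (2 + real k)" for k
  have h: "0 < h k" "h k < d" "h k < R - r" for k
  proof -
    have m: "0 < min d (R - r)" using d(1) r by simp
    then show "0 < h k" by (simp add: h_def)
    have "m / (2 + real k) < m" if "0 < m" for m :: real
      using that mult_strict_left_mono[of 1 "2 + real k" m] by (simp add: divide_less_eq)
    from this[OF m] have "h k < min d (R - r)" by (simp only: h_def)
    then show "h k < d" "h k < R - r" by simp_all
  qed
  have h0: "h \<longlonglongrightarrow> 0"
    unfolding h_def
    by (intro real_tendsto_divide_at_top[OF tendsto_const] filterlim_tendsto_add_at_top[OF tendsto_const]
        filterlim_real_sequentially)
  define P where "P k x t \<sigma>1 \<sigma>2 z \<longleftrightarrow> x \<in> cball 0 r \<and> t \<in> {\<tau>..t0} \<and> \<eta> x t > 0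
      \<and> \<sigma>1 \<in> {Z x t..Z (x + e (h k)) t} \<and> \<sigma>2 \<in> {Z x t..Z (x + e (h k)) t} \<and> z \<in> {0..h k}
      \<and> N \<le> \<eta> x t * (\<sigma> * Zi j (x + (z * \<sigma>) *\<^sub>R axis j 1) t)
      \<and> (\<Sum>i\<in>UNIV. \<eta>ii i x t) / \<eta> x t - \<eta>t x t / \<eta> x t - 2 * (eta_grad_norm x t)\<^sup>2 / (\<eta> x t)\<^sup>2
         \<le> a' \<sigma>1 * (grad_norm (x + e (h k)) t)\<^sup>2 - b' \<sigma>2 * grad_norm (x + e (h k)) t powr p
          + (a (Z x t) * (grad_norm x t + grad_norm (x + e (h k)) t)
            + p * b (Z x t) * max (grad_norm x t) (grad_norm (x + e (h k)) t) powr (p - 1))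
              * (eta_grad_norm x t / \<eta> x t)" for k x t \<sigma>1 \<sigma>2 z
  have "\<exists>x t \<sigma>1 \<sigma>2 z. P k x t \<sigma>1 \<sigma>2 z" for k
    unfolding P_def
  proof (rule difference_estimate[OF h(1) h(3) \<sigma> \<open>0 < N\<close> e_def hat(1,2)])
    show "h k * N \<le> \<eta> xh th * (Z (xh + e (h k)) th - Z xh th)"
      using d(2)[of "h k"] h[of k] by (simp add: pos_less_divide_eq mult.commute)
  qed
  then obtain X0 T0 S0 S0' z0 where P0: "\<And>k. P k (X0 k) (T0 k) (S0 k) (S0' k) (z0 k)"
    by metis
  have "compact (cball (0::real^'n) r \<times> {\<tau>..t0})" by (intro compact_Times compact_cball compact_Icc)
  moreover have "\<forall>k. (X0 k, T0 k) \<in> cball 0 r \<times> {\<tau>..t0}" using P0 by (simp add: P_def)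
  ultimately obtain q \<rho> where q: "q \<in> cball 0 r \<times> {\<tau>..t0}" and \<rho>: "strict_mono (\<rho> :: nat \<Rightarrow> nat)"
      and lim: "((\<lambda>k. (X0 k, T0 k)) \<circ> \<rho>) \<longlonglongrightarrow> q"
    unfolding compact_def by (elim allE[of _ "\<lambda>k. (X0 k, T0 k)"]) auto
  obtain x t where qxt: "q = (x, t)" by (cases q)
  have x: "x \<in> cball 0 r" and t: "t \<in> {\<tau>..t0}" using q qxt by auto
  define X where "X k = X0 (\<rho> k)" for k
  define Y where "Y k = T0 (\<rho> k)" for k
  define S where "S k = S0 (\<rho> k)" for k
  define S' where "S' k = S0' (\<rho> k)" for k
  define z where "z k = z0 (\<rho> k)" for k
  define H where "H k = h (\<rho> k)" for k
  have P: "P (\<rho> k) (X k) (Y k) (S k) (S' k) (z k)" for k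
    by (simp add: X_def Y_def S_def S'_def z_def P0)
  have lim: "(\<lambda>k. (X k, Y k)) \<longlonglongrightarrow> (x, t)" using lim by (simp add: o_def qxt X_def Y_def)
  have X: "X \<longlonglongrightarrow> x" and Y: "Y \<longlonglongrightarrow> t" using tendsto_fst[OF lim] tendsto_snd[OF lim] by simp_all
  have H: "H \<longlonglongrightarrow> 0" using LIMSEQ_subseq_LIMSEQ[OF h0 \<rho>] unfolding o_def H_def[symmetric] .
  have z: "z \<longlonglongrightarrow> 0"
    by (rule tendsto_sandwich[OF _ _ tendsto_const H]) (use P in \<open>auto simp: P_def H_def\<close>)
  have "(\<lambda>k. (X k + e (H k), Y k)) \<longlonglongrightarrow> (x + (0 * \<sigma>) *\<^sub>R axis j 1, t)"
    unfolding e_def by (intro tendsto_intros X Y H)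
  then have limE: "(\<lambda>k. (X k + e (H k), Y k)) \<longlonglongrightarrow> (x, t)" by simp
  have "(\<lambda>k. (X k + (z k * \<sigma>) *\<^sub>R axis j 1, Y k)) \<longlonglongrightarrow> (x + (0 * \<sigma>) *\<^sub>R axis j 1, t)"
    by (intro tendsto_intros X Y z)
  then have limz: "(\<lambda>k. (X k + (z k * \<sigma>) *\<^sub>R axis j 1, Y k)) \<longlonglongrightarrow> (x, t)" by simp
  have Q: "(x, t) \<in> ball 0 R \<times> {0<..<T}" using x t r times by auto
  have open_Q: "open (ball (0::real^'n) R \<times> {0<..<T})" by (intro open_Times) auto
  have cZ: "isCont (\<lambda>(x, t). Z x t) (x, t)" and cZi: "isCont (\<lambda>(x, t). Zi i x t) (x, t)" for i
    using Z_cont Zi_cont[of i] Q by (auto simp: continuous_on_eq_continuous_at[OF open_Q])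
  have c\<eta>: "isCont (\<lambda>(x, t). \<eta> x t) (x, t)" "isCont (\<lambda>(x, t). \<eta>t x t) (x, t)"
    "isCont (\<lambda>(x, t). \<eta>i i x t) (x, t)" "isCont (\<lambda>(x, t). \<eta>ii i x t) (x, t)" for i
    using \<eta>_cont by (auto simp: continuous_on_eq_continuous_at)
  have L\<eta>: "(\<lambda>k. \<eta> (X k) (Y k)) \<longlonglongrightarrow> \<eta> x t" "(\<lambda>k. \<eta>t (X k) (Y k)) \<longlonglongrightarrow> \<eta>t x t"
    "(\<lambda>k. \<eta>i i (X k) (Y k)) \<longlonglongrightarrow> \<eta>i i x t" "(\<lambda>k. \<eta>ii i (X k) (Y k)) \<longlonglongrightarrow> \<eta>ii i x t" for i
    using c\<eta>[THEN isCont_tendsto_compose, OF lim] by simp_all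
  have LZ: "(\<lambda>k. Z (X k) (Y k)) \<longlonglongrightarrow> Z x t" and LZe: "(\<lambda>k. Z (X k + e (H k)) (Y k)) \<longlonglongrightarrow> Z x t"
    using isCont_tendsto_compose[OF cZ lim] isCont_tendsto_compose[OF cZ limE] by simp_all
  have Lg: "(\<lambda>k. grad_norm (X k) (Y k)) \<longlonglongrightarrow> grad_norm x t"
    and Lge: "(\<lambda>k. grad_norm (X k + e (H k)) (Y k)) \<longlonglongrightarrow> grad_norm x t"
    unfolding grad_norm_def using isCont_tendsto_compose[OF cZi lim] isCont_tendsto_compose[OF cZi limE]
    by (auto intro!: tendsto_norm tendsto_vec_lambda)
  have Lez: "(\<lambda>k. eta_grad_norm (X k) (Y k)) \<longlonglongrightarrow> eta_grad_norm x t"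
    unfolding eta_grad_norm_def by (intro tendsto_norm tendsto_vec_lambda L\<eta>)
  \<comment> \<open>The intermediate values lie between \<open>Z\<close> at the maximum point and
    \<open>Z\<close> at its translate, and both converge to \<open>Z x t\<close>.\<close>
  have LS: "S \<longlonglongrightarrow> Z x t" and LS': "S' \<longlonglongrightarrow> Z x t"
    by (rule tendsto_sandwich[OF _ _ LZ LZe]; use P in \<open>auto simp: P_def H_def\<close>)+
  have l: "l < Z x t" using Z_range Q by auto
  have "(\<lambda>k. \<eta> (X k) (Y k) * (\<sigma> * Zi j (X k + (z k * \<sigma>) *\<^sub>R axis j 1) (Y k))) \<longlonglongrightarrow> \<eta> x t * (\<sigma> * Zi j x t)"
    using isCont_tendsto_compose[OF cZi limz] by (intro tendsto_intros L\<eta>) simp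
  then have N: "N \<le> \<eta> x t * (\<sigma> * Zi j x t)"
    by (rule LIMSEQ_le_const) (use P in \<open>auto simp: P_def\<close>)
  \<comment> \<open>Positivity of \<open>\<eta>\<close> could be lost in the limit; the lower bound
    by \<open>N > 0\<close> preserves it.\<close>
  then have pos: "\<eta> x t > 0" using \<open>0 < N\<close> \<eta>_nonneg[OF x t] by (cases "\<eta> x t = 0") auto
  then have x': "x \<in> ball 0 r" and t': "t \<in> {\<tau><..t0}"
    using \<eta>_boundary[of x t] x t by (auto simp: less_le)
  have "(\<Sum>i\<in>UNIV. \<eta>ii i x t) / \<eta> x t - \<eta>t x t / \<eta> x t - 2 * (eta_grad_norm x t)\<^sup>2 / (\<eta> x t)\<^sup>2
         \<le> a' (Z x t) * (grad_norm x t)\<^sup>2 - b' (Z x t) * grad_norm x t powr p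
          + (a (Z x t) * (grad_norm x t + grad_norm x t)
            + p * b (Z x t) * max (grad_norm x t) (grad_norm x t) powr (p - 1))
              * (eta_grad_norm x t / \<eta> x t)"
  proof (rule LIMSEQ_le)
    show "(\<lambda>k. (\<Sum>i\<in>UNIV. \<eta>ii i (X k) (Y k)) / \<eta> (X k) (Y k) - \<eta>t (X k) (Y k) / \<eta> (X k) (Y k)
          - 2 * (eta_grad_norm (X k) (Y k))\<^sup>2 / (\<eta> (X k) (Y k))\<^sup>2)
       \<longlonglongrightarrow> (\<Sum>i\<in>UNIV. \<eta>ii i x t) / \<eta> x t - \<eta>t x t / \<eta> x t - 2 * (eta_grad_norm x t)\<^sup>2 / (\<eta> x t)\<^sup>2"
      using pos by (intro tendsto_intros L\<eta> Lez) auto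
    show "(\<lambda>k. a' (S k) * (grad_norm (X k + e (H k)) (Y k))\<^sup>2 - b' (S' k) * grad_norm (X k + e (H k)) (Y k) powr p
          + (a (Z (X k) (Y k)) * (grad_norm (X k) (Y k) + grad_norm (X k + e (H k)) (Y k))
            + p * b (Z (X k) (Y k)) * max (grad_norm (X k) (Y k)) (grad_norm (X k + e (H k)) (Y k)) powr (p - 1))
              * (eta_grad_norm (X k) (Y k) / \<eta> (X k) (Y k)))
       \<longlonglongrightarrow> a' (Z x t) * (grad_norm x t)\<^sup>2 - b' (Z x t) * grad_norm x t powr p
          + (a (Z x t) * (grad_norm x t + grad_norm x t)
            + p * b (Z x t) * max (grad_norm x t) (grad_norm x t) powr (p - 1))
              * (eta_grad_norm x t / \<eta> x t)"
      using pos p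
      by (intro tendsto_add tendsto_diff tendsto_mult tendsto_divide tendsto_power tendsto_const tendsto_max
          tendsto_powr' L\<eta> Lez Lg Lge
          isCont_tendsto_compose[OF a'(2)[OF l] LS] isCont_tendsto_compose[OF b'(2)[OF l] LS']
          isCont_tendsto_compose[OF DERIV_isCont[OF a'(1)[OF l]] LZ]
          isCont_tendsto_compose[OF DERIV_isCont[OF b'(1)[OF l]] LZ])
        (auto simp: grad_norm_def le_max_iff_disj)
    show "\<exists>N. \<forall>k\<ge>N. (\<Sum>i\<in>UNIV. \<eta>ii i (X k) (Y k)) / \<eta> (X k) (Y k) - \<eta>t (X k) (Y k) / \<eta> (X k) (Y k)
          - 2 * (eta_grad_norm (X k) (Y k))\<^sup>2 / (\<eta> (X k) (Y k))\<^sup>2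
        \<le> a' (S k) * (grad_norm (X k + e (H k)) (Y k))\<^sup>2 - b' (S' k) * grad_norm (X k + e (H k)) (Y k) powr p
          + (a (Z (X k) (Y k)) * (grad_norm (X k) (Y k) + grad_norm (X k + e (H k)) (Y k))
            + p * b (Z (X k) (Y k)) * max (grad_norm (X k) (Y k)) (grad_norm (X k + e (H k)) (Y k)) powr (p - 1))
              * (eta_grad_norm (X k) (Y k) / \<eta> (X k) (Y k))"
      using P by (auto simp: P_def H_def)
  qed
  then have "(\<Sum>i\<in>UNIV. \<eta>ii i x t) / \<eta> x t - \<eta>t x t / \<eta> x t - 2 * (eta_grad_norm x t)\<^sup>2 / (\<eta> x t)\<^sup>2
         \<le> a' (Z x t) * (grad_norm x t)\<^sup>2 - b' (Z x t) * grad_norm x t powr p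
          + (2 * a (Z x t) * grad_norm x t + p * b (Z x t) * grad_norm x t powr (p - 1))
              * (eta_grad_norm x t / \<eta> x t)"
    by (simp add: algebra_simps)
  with pos N x' t' show ?thesis by blast
qed

end

section \<open>The cutoff function\<close>

definition cutoff_base :: "real \<Rightarrow> 'a::real_inner \<Rightarrow> real" where
  "cutoff_base r x = 1 - (x \<bullet> x) / r\<^sup>2"

lemma DERIV_cutoff_base:
  fixes x :: "real^'n::finite"
  shows "((\<lambda>s. cutoff_base r (x + s *\<^sub>R axis i 1)) has_real_derivative - (2 * x $ i / r\<^sup>2)) (at 0)"
proof -
  have "(\<lambda>s. cutoff_base r (x + s *\<^sub>R axis i 1)) = (\<lambda>s. 1 - (x \<bullet> x + 2 * s * x $ i + s\<^sup>2) / r\<^sup>2)"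
    by (simp add: fun_eq_iff cutoff_base_def inner_add_left inner_add_right inner_axis inner_axis' power2_eq_square algebra_simps)
  then show ?thesis unfolding divide_inverse by (auto intro!: derivative_eq_intros)
qed

lemma continuous_on_cutoff_base [continuous_intros]:
  "continuous_on S f \<Longrightarrow> continuous_on S (\<lambda>q. cutoff_base r (f q))"
  unfolding cutoff_base_def divide_inverse by (intro continuous_intros)

text \<open>A power of the paraboloid times a linear ramp in time. Being polynomial in
  \<open>x\<close> and affine in \<open>t\<close>, it has derivative formulas valid everywhere,
  while its sign matters on the closed cylinder. At \<open>t = t0\<close> it reduces to the spatial
  factor.\<close>

definition "cutoff k r \<tau> t0 x t = cutoff_base r x ^ k * ((t - \<tau>) / (t0 - \<tau>))"
definition "cutoff_i k r \<tau> t0 i (x :: real^'n::finite) t =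
  - (real k * cutoff_base r x ^ (k - 1) * (2 * x $ i / r\<^sup>2) * ((t - \<tau>) / (t0 - \<tau>)))"
text \<open>For \<open>k\<close> below 2 the truncated exponents are harmless, since the
  coefficients in front of them vanish.\<close>

definition "cutoff_ii k r \<tau> t0 i (x :: real^'n::finite) t =
  (real k * real (k - 1) * cutoff_base r x ^ (k - 2) * (2 * x $ i / r\<^sup>2)\<^sup>2
    - real k * cutoff_base r x ^ (k - 1) * (2 / r\<^sup>2)) * ((t - \<tau>) / (t0 - \<tau>))"
definition "cutoff_t k r \<tau> t0 x t = cutoff_base r x ^ k / (t0 - \<tau>)"

lemma DERIV_cutoff:
  fixes x :: "real^'n::finite"
  shows "((\<lambda>s. cutoff k r \<tau> t0 (x + s *\<^sub>R axis i 1) t) has_real_derivative cutoff_i k r \<tau> t0 i x t) (at 0)"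
    and "((\<lambda>s. cutoff_i k r \<tau> t0 i (x + s *\<^sub>R axis i 1) t) has_real_derivative cutoff_ii k r \<tau> t0 i x t) (at 0)"
    and "((\<lambda>s. cutoff k r \<tau> t0 x s) has_real_derivative cutoff_t k r \<tau> t0 x t) (at t)"
proof -
  note d = DERIV_cutoff_base[of r x i]
  show "((\<lambda>s. cutoff k r \<tau> t0 (x + s *\<^sub>R axis i 1) t) has_real_derivative cutoff_i k r \<tau> t0 i x t) (at 0)"
    unfolding cutoff_def cutoff_i_def by (rule derivative_eq_intros d refl)+ simp
  have "(\<lambda>s. 2 * (x + s *\<^sub>R axis i 1) $ i / r\<^sup>2) = (\<lambda>s. (2 * x $ i + 2 * s) / r\<^sup>2)"
    by (simp add: fun_eq_iff axis_def)
  then have lin: "((\<lambda>s. 2 * (x + s *\<^sub>R axis i 1) $ i / r\<^sup>2) has_real_derivative 2 / r\<^sup>2) (at 0)"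
    unfolding divide_inverse by (auto intro!: derivative_eq_intros)
  have k: "k - Suc (Suc 0) = k - 2" by simp
  show "((\<lambda>s. cutoff_i k r \<tau> t0 i (x + s *\<^sub>R axis i 1) t) has_real_derivative cutoff_ii k r \<tau> t0 i x t) (at 0)"
    unfolding cutoff_ii_def cutoff_i_def
    by (rule derivative_eq_intros d lin refl)+ (simp add: k power2_eq_square algebra_simps)
  show "((\<lambda>s. cutoff k r \<tau> t0 x s) has_real_derivative cutoff_t k r \<tau> t0 x t) (at t)"
    unfolding cutoff_def cutoff_t_def divide_inverse by (rule derivative_eq_intros refl)+ simp
qed

lemma continuous_on_cutoff:
  "continuous_on S (\<lambda>(x :: real^'n::finite, t). cutoff k r \<tau> t0 x t)"
  "continuous_on S (\<lambda>(x, t). cutoff_i k r \<tau> t0 (i :: 'n) x t)"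
  "continuous_on S (\<lambda>(x, t). cutoff_ii k r \<tau> t0 (i :: 'n) x t)"
  "continuous_on S (\<lambda>(x :: real^'n, t). cutoff_t k r \<tau> t0 x t)"
  unfolding cutoff_def cutoff_i_def cutoff_ii_def cutoff_t_def case_prod_beta divide_inverse
  by (intro continuous_intros)+

lemma cutoff_base_bounds:
  assumes "norm x < r"
  shows "0 < cutoff_base r x" "cutoff_base r x \<le> 1"
proof -
  have "(norm x)\<^sup>2 < r\<^sup>2" using assms by (intro power_strict_mono) auto
  then show "0 < cutoff_base r x" by (simp add: cutoff_base_def dot_square_norm divide_less_eq)
  show "cutoff_base r x \<le> 1" by (simp add: cutoff_base_def)
qed

text \<open>Each spatial derivative costs a factor \<open>1 / (r * \<phi>)\<close> relative to the
  cutoff. The constant \<open>8 * k^2\<close> is twice the square of the gradient bound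
  \<open>2 * k\<close>; the term with \<open>CARD('n)\<close> comes from the Laplacian of the
  paraboloid, after the nonnegative part of \<open>cutoff_ii\<close> is dropped and
  \<open>1 / \<phi>\<close> is enlarged to its square. The ramp contributes exactly
  \<open>1 / (t - \<tau>)\<close>.\<close>

lemma cutoff_log_derivative_bounds:
  fixes x :: "real^'n::finite"
  assumes x: "norm x < r" and t: "\<tau> < t" "\<tau> < t0" and k: "k \<ge> 2"
  shows "norm (\<chi> i. cutoff_i k r \<tau> t0 i x t) / cutoff k r \<tau> t0 x t \<le> 2 * real k / (r * cutoff_base r x)"
    and "- (1 / (t - \<tau>) + (8 * (real k)\<^sup>2 + 2 * real CARD('n) * real k) / (r\<^sup>2 * (cutoff_base r x)\<^sup>2))
      \<le> (\<Sum>i\<in>UNIV. cutoff_ii k r \<tau> t0 i x t) / cutoff k r \<tau> t0 x t - cutoff_t k r \<tau> t0 x t / cutoff k r \<tau> t0 x t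
        - 2 * (norm (\<chi> i. cutoff_i k r \<tau> t0 i x t))\<^sup>2 / (cutoff k r \<tau> t0 x t)\<^sup>2"
proof -
  define \<phi> where "\<phi> = cutoff_base r x"
  define \<theta> where "\<theta> = (t - \<tau>) / (t0 - \<tau>)"
  obtain j where kj: "k = j + 2" using k by (metis add.commute le_Suc_ex)
  have r: "r > 0" using x by (meson norm_ge_zero order_le_less_trans)
  have pos: "\<phi> > 0" "\<phi> \<le> 1" "\<theta> > 0"
    using cutoff_base_bounds[OF x] t by (auto simp: \<phi>_def \<theta>_def)
  have \<eta>: "cutoff k r \<tau> t0 x t = \<phi> ^ k * \<theta>" "cutoff_t k r \<tau> t0 x t = \<phi> ^ k / (t0 - \<tau>)"
    by (simp_all add: cutoff_def cutoff_t_def \<phi>_def \<theta>_def)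
  have "(\<chi> i. cutoff_i k r \<tau> t0 i x t) = (- (real k * \<phi> ^ (k - 1) * (2 / r\<^sup>2) * \<theta>)) *\<^sub>R x"
    by (simp add: vec_eq_iff cutoff_i_def \<phi>_def \<theta>_def)
  then have "norm (\<chi> i. cutoff_i k r \<tau> t0 i x t) = real k * \<phi> ^ (k - 1) * (2 / r\<^sup>2) * \<theta> * norm x"
    using pos by (simp add: abs_mult)
  then have G: "norm (\<chi> i. cutoff_i k r \<tau> t0 i x t) / cutoff k r \<tau> t0 x t = 2 * real k * norm x / (r\<^sup>2 * \<phi>)"
    using pos r unfolding \<eta> by (simp add: kj field_simps)
  also have "\<dots> \<le> 2 * real k * r / (r\<^sup>2 * \<phi>)"
    using pos r x by (intro divide_right_mono mult_left_mono) auto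
  also have "\<dots> = 2 * real k / (r * \<phi>)" using r by (simp add: power2_eq_square)
  finally show G_le: "norm (\<chi> i. cutoff_i k r \<tau> t0 i x t) / cutoff k r \<tau> t0 x t \<le> 2 * real k / (r * cutoff_base r x)"
    by (simp add: \<phi>_def)
  have "(norm (\<chi> i. cutoff_i k r \<tau> t0 i x t) / cutoff k r \<tau> t0 x t)\<^sup>2 \<le> (2 * real k / (r * \<phi>))\<^sup>2"
    using G_le pos unfolding \<phi>_def[symmetric] \<eta> by (intro power_mono) auto
  then have G2: "2 * (norm (\<chi> i. cutoff_i k r \<tau> t0 i x t))\<^sup>2 / (cutoff k r \<tau> t0 x t)\<^sup>2 \<le> 8 * (real k)\<^sup>2 / (r\<^sup>2 * \<phi>\<^sup>2)"
    by (simp add: power_divide power_mult_distrib)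
  have T: "cutoff_t k r \<tau> t0 x t / cutoff k r \<tau> t0 x t = 1 / (t - \<tau>)"
  proof -
    have "a / b / (a * (d / b)) = 1 / d" if "a > 0" "b > 0" "d > 0" for a b d :: real
      using that by (simp add: field_simps)
    from this[of "\<phi> ^ k" "t0 - \<tau>" "t - \<tau>"] show ?thesis using pos t unfolding \<eta> \<theta>_def by simp
  qed
  have "cutoff_ii k r \<tau> t0 i x t \<ge> - (real k * \<phi> ^ (k - 1) * (2 / r\<^sup>2) * \<theta>)" for i
  proof -
    have "0 \<le> real k * real (k - 1) * \<phi> ^ (k - 2) * (2 * x $ i / r\<^sup>2)\<^sup>2 * \<theta>" using pos by simp
    then show ?thesis by (simp add: cutoff_ii_def \<phi>_def[symmetric] \<theta>_def[symmetric] algebra_simps)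
  qed
  then have "(\<Sum>i\<in>(UNIV::'n set). - (real k * \<phi> ^ (k - 1) * (2 / r\<^sup>2) * \<theta>)) \<le> (\<Sum>i\<in>UNIV. cutoff_ii k r \<tau> t0 i x t)"
    by (intro sum_mono)
  then have "(\<Sum>i\<in>UNIV. cutoff_ii k r \<tau> t0 i x t) / cutoff k r \<tau> t0 x t
      \<ge> - (real CARD('n) * (real k * \<phi> ^ (k - 1) * (2 / r\<^sup>2) * \<theta>)) / (\<phi> ^ k * \<theta>)"
    using pos unfolding \<eta> by (intro divide_right_mono) auto
  also have "- (real CARD('n) * (real k * \<phi> ^ (k - 1) * (2 / r\<^sup>2) * \<theta>)) / (\<phi> ^ k * \<theta>)
      = - (2 * real CARD('n) * real k / (r\<^sup>2 * \<phi>))"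
    using pos r unfolding kj by (simp add: field_simps)
  finally have L1: "(\<Sum>i\<in>UNIV. cutoff_ii k r \<tau> t0 i x t) / cutoff k r \<tau> t0 x t \<ge> - (2 * real CARD('n) * real k / (r\<^sup>2 * \<phi>))" .
  have "\<phi>\<^sup>2 \<le> \<phi>" using pos by (simp add: power2_eq_square mult_left_le)
  then have "2 * real CARD('n) * real k / (r\<^sup>2 * \<phi>) \<le> 2 * real CARD('n) * real k / (r\<^sup>2 * \<phi>\<^sup>2)"
    using pos r by (intro divide_left_mono mult_left_mono) auto
  with L1 G2 T show "- (1 / (t - \<tau>) + (8 * (real k)\<^sup>2 + 2 * real CARD('n) * real k) / (r\<^sup>2 * (cutoff_base r x)\<^sup>2))
      \<le> (\<Sum>i\<in>UNIV. cutoff_ii k r \<tau> t0 i x t) / cutoff k r \<tau> t0 x t - cutoff_t k r \<tau> t0 x t / cutoff k r \<tau> t0 x t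
        - 2 * (norm (\<chi> i. cutoff_i k r \<tau> t0 i x t))\<^sup>2 / (cutoff k r \<tau> t0 x t)\<^sup>2"
    by (simp add: \<phi>_def[symmetric] add_divide_distrib)
qed

section \<open>The logarithmic change of variables\<close>

text \<open>Up to sign, the ratio between the gradient of \<open>Z\<close> and that of
  \<open>u\<close>.\<close>

definition "log_profile_deriv c L v = c * v powr (c - 1) / (v powr c + L)"

lemma DERIV_log_profile:
  fixes v :: real
  assumes "v > 0" "L > 0"
  shows "((\<lambda>v. ln (v powr c + L)) has_real_derivative log_profile_deriv c L v) (at v)"
  unfolding log_profile_deriv_def using assms
  by (auto intro!: derivative_eq_intros simp: add_pos_pos)

lemma log_profile_deriv_pos:
  fixes v :: real
  assumes "v > 0" "L > 0" "c > 0"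
  shows "log_profile_deriv c L v > 0"
  using assms by (simp add: log_profile_deriv_def add_pos_pos)

text \<open>The derivative is written as a multiple of the square of
  \<open>log_profile_deriv\<close> because it multiplies the squared gradient of \<open>u\<close> in
  the Laplacian of \<open>Z\<close>. The multiplier is then precisely the coefficient
  \<open>\<alpha>\<close> of the squared gradient of \<open>Z\<close>.\<close>

lemma DERIV_log_profile_deriv:
  fixes v :: real
  assumes v: "v > 0" "L > 0" and c: "c > 0"
  shows "(log_profile_deriv c L has_real_derivative
      - ((1 + (1 / c - 1) * (v powr c + L) / v powr c) * (log_profile_deriv c L v)\<^sup>2)) (at v)"
proof -
  define w where "w = v powr c"
  have w: "w > 0" "w + L > 0" using v by (auto simp: w_def add_pos_pos)
  have pw: "v powr (c - 1) = w / v" "v powr (c - 2) = w / v\<^sup>2" "v powr (c - 1 - 1) = w / v\<^sup>2"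
    using v by (simp_all add: w_def powr_diff powr_numeral power2_eq_square)
  have "(log_profile_deriv c L has_real_derivative
     ((c * ((c - 1) * v powr (c - 1 - 1))) * (v powr c + L) - c * v powr (c - 1) * (c * v powr (c - 1)))
       / ((v powr c + L) * (v powr c + L))) (at v)"
    unfolding log_profile_deriv_def[abs_def] using v w(2)[unfolded w_def]
    by (auto intro!: derivative_eq_intros)
  also have "((c * ((c - 1) * v powr (c - 1 - 1))) * (v powr c + L) - c * v powr (c - 1) * (c * v powr (c - 1)))
       / ((v powr c + L) * (v powr c + L)) = - ((1 + (1 / c - 1) * (v powr c + L) / v powr c) * (log_profile_deriv c L v)\<^sup>2)"
  proof -
    have "((c * ((c - 1) * (w / v\<^sup>2))) * W - c * (w / v) * (c * (w / v))) / (W * W)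
        = - ((1 + (1 / c - 1) * W / w) * (c * (w / v) / W)\<^sup>2)" if "W > 0" for W
      using that w v c by (simp add: field_simps power2_eq_square)
    from this[OF w(2)] show ?thesis by (simp only: log_profile_deriv_def pw w_def[symmetric])
  qed
  finally show ?thesis .
qed

text \<open>This identifies \<open>\<beta>\<close>: it expresses the transformed source term through
  the \<open>p\<close>-th power of the gradient of \<open>Z\<close>. The coefficient involves only
  \<open>w = v powr c\<close> and \<open>L\<close>, hence is a function of \<open>Z\<close>.\<close>

lemma log_profile_deriv_powr:
  fixes v p :: real
  assumes v: "v > 0" "L > 0" and p: "p > 1" and c: "c = (p - 1) / p"
  shows "c powr (1 - p) * v powr c * (v powr c + L) powr (p - 1) * log_profile_deriv c L v powr p
    = log_profile_deriv c L v"
proof -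
  have c0: "c > 0" using p c by simp
  have W: "v powr c + L > 0" using v by (simp add: add_pos_pos)
  \<comment> \<open>Both sides equal -1. The right-hand form exhibits the factor
    \<open>v powr (c - 1)\<close> of the derivative and the factor \<open>v powr c\<close> that
    cancels.\<close>
  have e: "(c - 1) * p = c - 1 - c" using p unfolding c by (simp add: field_simps)
  have "log_profile_deriv c L v powr p = c powr p * v powr ((c - 1) * p) / (v powr c + L) powr p"
    using v c0 W by (simp add: log_profile_deriv_def powr_mult powr_divide powr_powr)
  also have "\<dots> = c powr p * (v powr (c - 1) / v powr c) / (v powr c + L) powr p"
    unfolding e by (simp add: powr_diff)
  finally show ?thesis
    using v c0 W by (simp add: log_profile_deriv_def powr_diff)
qed

section \<open>The gradient estimate\<close>

text \<open>Here \<open>y = r z\<close>. The good term \<open>\<kappa> W\<^sup>p z\<^sup>p\<close> dominates both \<open>y\<^sup>p / r\<^sup>2\<close> and \<open>y\<^sup>p / t0\<close> because \<open>W \<ge> L\<close>; the exponent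
  \<open>k\<close> of the cutoff is chosen so that \<open>y\<^bsup>p-1\<^esup>\<close> beats \<open>1 / \<phi>\<close> even for \<open>p\<close> close to 1. The part of the drift that
  degenerates as \<open>w \<rightarrow> 0\<close> is absorbed by the other good term \<open>m L W z\<^sup>2 / w\<^sup>2\<close>.\<close>

lemma bernstein_absorption:
  fixes p A k c1 r t0 L w W \<phi> \<theta> z G \<kappa> m :: real
  assumes p: "p > 1" "m = 1 / (p - 1)" and k: "k \<ge> 2" "k * (p - 1) \<ge> 1"
    and A: "A \<ge> 16 + 16 * c1 + 4 * k + 16 * k * p" "A powr (p - 1) \<ge> 64 * k * (1 + m)"
    and pos: "c1 \<ge> 0" "r > 0" "t0 > 0" "L > 0" "w > 0" "W = w + L" "\<kappa> \<ge> 1"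
    and \<phi>: "0 < \<phi>" "\<phi> \<le> 1" and \<theta>: "0 < \<theta>" "\<theta> \<le> 1" and z: "z > 0"
    and L: "L powr p \<ge> r powr p * (1 / (2 * r\<^sup>2) + 1 / t0)"
    and large: "A \<le> r * (\<phi> powr k * \<theta>) * z"
    and G: "0 \<le> G" "G \<le> 2 * k / (r * \<phi>)"
    and ineq: "- (2 / (t0 * \<theta>) + c1 / (r\<^sup>2 * \<phi>\<^sup>2))
      \<le> - (m * L * W / w\<^sup>2) * z\<^sup>2 - \<kappa> * (W powr p + (p - 1) * w * W powr (p - 1)) * z powr p
        + (2 * (1 + m * W / w) * z + p * (\<kappa> * (w * W powr (p - 1))) * z powr (p - 1)) * G"
  shows False
proof -
  define y where "y = r * z"
  define Q where "Q = \<kappa> * (W powr p * z powr p)"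
  have m: "m > 0" using p by simp
  have kp: "0 \<le> k * p" using k p by simp
  have A1: "A \<ge> 16" "A \<ge> 16 * c1" "A \<ge> 4 * k" "A \<ge> 16 * k * p" using A(1) pos(1) k kp by linarith+
  have W: "W > 0" "w \<le> W" "L \<le> W" using pos by auto
  have y0: "y > 0" using pos z by (simp add: y_def)
  have f1: "0 < \<phi> powr k" "\<phi> powr k \<le> 1" using \<phi> k by (auto intro: powr_le1)
  have f2: "\<phi> powr k \<le> \<phi>\<^sup>2"
    using powr_mono'[of 2 k \<phi>] \<phi> k by simp
  have large': "A \<le> \<phi> powr k * \<theta> * y" using large by (simp add: y_def mult_ac)
  have ya: "A / (\<phi> powr k) \<le> y"
  proof -
    have "\<phi> powr k * \<theta> * y \<le> \<phi> powr k * 1 * y" using \<theta> f1 y0 by (intro mult_right_mono mult_left_mono) auto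
    then show ?thesis using large' f1 by (simp add: divide_le_eq mult.commute)
  qed
  have yA: "A \<le> y" using ya f1 A1 by (smt (verit) divide_le_eq mult_left_le)
  have y1: "y \<ge> 1" using yA A1 by linarith
  have yy: "y \<le> y powr p" using powr_mono[of 1 p y] p y1 by simp
  have c: "\<phi> powr k * y \<le> \<phi> * y"
  proof -
    have "\<phi>\<^sup>2 \<le> \<phi>" using \<phi> by (simp add: power2_eq_square mult_left_le)
    then show ?thesis using f2 y0 by (intro mult_right_mono) auto
  qed
  \<comment> \<open>Largeness of the gradient trades each logarithmic derivative of the cutoff for a
    small multiple of \<open>z\<close>; this is how \<open>A\<close> enters \<open>T3'\<close> and
    \<open>T4\<close>.\<close>
  have d: "1 / (r * \<phi>) \<le> z / A"
  proof -
    have "\<phi> powr k * \<theta> * y \<le> \<phi> powr k * 1 * y" using \<theta> f1 y0 by (intro mult_right_mono mult_left_mono) auto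
    then have "A \<le> \<phi> * y" using large' c by simp
    then show ?thesis using A1 \<phi> pos by (simp add: y_def field_simps)
  qed
  have Q: "Q \<ge> y powr p * (1 / (2 * r\<^sup>2)) + y powr p / t0"
  proof -
    have "y powr p * (1 / (2 * r\<^sup>2) + 1 / t0) = (r powr p * (1 / (2 * r\<^sup>2) + 1 / t0)) * z powr p"
      using pos z by (simp add: y_def powr_mult)
    also have "\<dots> \<le> L powr p * z powr p" using L by (intro mult_right_mono) auto
    also have "\<dots> \<le> W powr p * z powr p" using W pos p by (intro mult_right_mono powr_mono2) auto
    also have "\<dots> \<le> Q" unfolding Q_def using pos mult_right_mono[of 1 \<kappa> "W powr p * z powr p"] by simp
    finally show ?thesis by (simp add: distrib_left)
  qed
  have Qa: "y powr p / r\<^sup>2 \<le> 2 * Q" and Qb: "y powr p / t0 \<le> Q"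
  proof -
    have "0 \<le> y powr p * (1 / (2 * r\<^sup>2))" "0 \<le> y powr p / t0" using pos by auto
    moreover have "y powr p / r\<^sup>2 = 2 * (y powr p * (1 / (2 * r\<^sup>2)))" by simp
    ultimately show "y powr p / r\<^sup>2 \<le> 2 * Q" "y powr p / t0 \<le> Q" using Q by linarith+
  qed
  have Qpos: "Q > 0" using W z pos by (simp add: Q_def)
  have T1: "2 / (t0 * \<theta>) \<le> Q / 8"
  proof -
    have "\<phi> powr k * (\<theta> * y) \<le> 1 * (\<theta> * y)" using f1 \<theta> y0 by (intro mult_right_mono) auto
    then have "A \<le> \<theta> * y" using large' by (simp only: mult.assoc)
    then have "16 \<le> \<theta> * y" using A1 by linarith
    then have "2 / (t0 * \<theta>) \<le> y / t0 / 8" using \<theta> pos by (simp add: field_simps)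
    also have "\<dots> \<le> y powr p / t0 / 8" using yy pos by (intro divide_right_mono) auto
    finally show ?thesis using Qb by simp
  qed
  have T2: "c1 / (r\<^sup>2 * \<phi>\<^sup>2) \<le> Q / 8"
  proof -
    have "A / \<phi>\<^sup>2 \<le> A / \<phi> powr k" using f1 f2 \<phi> A1 by (intro divide_left_mono) auto
    then have "A / \<phi>\<^sup>2 \<le> y" using ya by simp
    moreover have "16 * c1 / \<phi>\<^sup>2 \<le> A / \<phi>\<^sup>2" using A1 by (intro divide_right_mono) auto
    moreover have "16 * c1 / \<phi>\<^sup>2 = 16 * (c1 / \<phi>\<^sup>2)" by simp
    ultimately have "c1 / \<phi>\<^sup>2 \<le> y powr p / 16" using yy by linarith
    then have "c1 / \<phi>\<^sup>2 / r\<^sup>2 \<le> y powr p / 16 / r\<^sup>2" by (intro divide_right_mono) auto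
    also have "\<dots> \<le> Q / 8" using Qa by simp
    finally show ?thesis by (simp add: mult.commute)
  qed
  have T3: "2 * (1 + m) * z * (2 * k / (r * \<phi>)) \<le> Q / 8"
  proof -
    have "A powr (p - 1) / \<phi> \<le> (A / \<phi> powr k) powr (p - 1)"
    proof -
      have "\<phi> powr (k * (p - 1)) \<le> \<phi>" using powr_mono'[of 1 "k * (p - 1)" \<phi>] k \<phi> by simp
      then have "A powr (p - 1) / \<phi> \<le> A powr (p - 1) / \<phi> powr (k * (p - 1))"
        using \<phi> by (intro divide_left_mono) auto
      also have "\<dots> = (A / \<phi> powr k) powr (p - 1)"
        using A1 f1 by (simp add: powr_divide powr_powr)
      finally show ?thesis .
    qed
    also have "\<dots> \<le> y powr (p - 1)" using ya f1 A1 p by (intro powr_mono2) auto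
    finally have "64 * k * (1 + m) / \<phi> \<le> y powr (p - 1)"
      using divide_right_mono[OF A(2), of \<phi>] \<phi> by linarith
    then have "64 * k * (1 + m) / \<phi> * y \<le> y powr (p - 1) * y" using y0 by (intro mult_right_mono) auto
    also have "\<dots> = y powr p" using y0 by (simp add: powr_diff)
    finally have "64 * k * (1 + m) / \<phi> * y / r\<^sup>2 \<le> y powr p / r\<^sup>2" by (intro divide_right_mono) auto
    then have "64 * k * (1 + m) / \<phi> * y / r\<^sup>2 \<le> 2 * Q" using Qa by linarith
    moreover have "64 * k * (1 + m) / \<phi> * y / r\<^sup>2 = 16 * (2 * (1 + m) * z * (2 * k / (r * \<phi>)))"
      using pos \<phi> by (simp add: y_def field_simps power2_eq_square)
    ultimately show ?thesis by linarith
  qed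
  have T3': "2 * (m * L / w) * z * (2 * k / (r * \<phi>)) \<le> (m * L * W / w\<^sup>2) * z\<^sup>2"
  proof -
    have "2 * (m * L / w) * z * (2 * k / (r * \<phi>)) = (4 * k * (m * L / w) * z) * (1 / (r * \<phi>))" by simp
    also have "\<dots> \<le> (4 * k * (m * L / w) * z) * (z / A)" using d k m pos z by (intro mult_left_mono) auto
    also have "\<dots> = (4 * k / A) * ((m * L / w) * z\<^sup>2)" by (simp add: power2_eq_square mult_ac)
    also have "\<dots> \<le> 1 * ((m * L / w) * z\<^sup>2)" using A1 m pos by (intro mult_right_mono) (auto simp: divide_le_eq)
    also have "\<dots> = (m * L / w) * z\<^sup>2 * 1" by simp
    also have "\<dots> \<le> (m * L / w) * z\<^sup>2 * (W / w)" using W m pos by (intro mult_left_mono) auto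
    finally show ?thesis by (simp add: power2_eq_square mult_ac)
  qed
  have T4: "p * (\<kappa> * (w * W powr (p - 1))) * z powr (p - 1) * (2 * k / (r * \<phi>)) \<le> Q / 8"
  proof -
    have "p * (\<kappa> * (w * W powr (p - 1))) * z powr (p - 1) * (2 * k / (r * \<phi>))
        = (2 * k * p * (\<kappa> * (w * W powr (p - 1))) * z powr (p - 1)) * (1 / (r * \<phi>))" by simp
    also have "\<dots> \<le> (2 * k * p * (\<kappa> * (w * W powr (p - 1))) * z powr (p - 1)) * (z / A)"
      using d k p pos by (intro mult_left_mono) auto
    also have "\<dots> = (2 * k * p / A) * (\<kappa> * ((w * W powr (p - 1)) * z powr p))"
      using z by (simp add: powr_diff mult_ac)
    also have "\<dots> \<le> (1 / 8) * (\<kappa> * ((w * W powr (p - 1)) * z powr p))"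
      using A1 pos by (intro mult_right_mono) (auto simp: divide_le_eq)
    also have "\<dots> \<le> (1 / 8) * (\<kappa> * ((W * W powr (p - 1)) * z powr p))"
      using W pos by (intro mult_left_mono mult_right_mono) auto
    also have "W * W powr (p - 1) = W powr p" using W by (simp add: powr_diff)
    finally show ?thesis by (simp add: Q_def)
  qed
  have "(2 * (1 + m * W / w) * z + p * (\<kappa> * (w * W powr (p - 1))) * z powr (p - 1)) * G
      \<le> (2 * (1 + m * W / w) * z + p * (\<kappa> * (w * W powr (p - 1))) * z powr (p - 1)) * (2 * k / (r * \<phi>))"
    using G(2) m W pos z p by (intro mult_left_mono add_nonneg_nonneg) auto
  \<comment> \<open>Writing \<open>W = w + L\<close> splits the drift into a bounded part and a part
    singular as \<open>w\<close> tends to 0. The latter is cancelled by the derivative of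
    \<open>\<alpha>\<close>.\<close>
  also have "\<dots> = 2 * (1 + m) * z * (2 * k / (r * \<phi>)) + 2 * (m * L / w) * z * (2 * k / (r * \<phi>))
      + p * (\<kappa> * (w * W powr (p - 1))) * z powr (p - 1) * (2 * k / (r * \<phi>))"
  proof -
    have "1 + m * W / w = (1 + m) + m * L / w" using pos by (simp add: field_simps)
    then show ?thesis by (simp only: distrib_left distrib_right)
  qed
  also have "\<dots> \<le> Q / 8 + (m * L * W / w\<^sup>2) * z\<^sup>2 + Q / 8" using T3 T3' T4 by linarith
  finally have E: "(2 * (1 + m * W / w) * z + p * (\<kappa> * (w * W powr (p - 1))) * z powr (p - 1)) * G
      \<le> Q / 8 + (m * L * W / w\<^sup>2) * z\<^sup>2 + Q / 8" .
  have "\<kappa> * (W powr p + (p - 1) * w * W powr (p - 1)) * z powr p \<ge> Q"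
  proof -
    have "0 \<le> \<kappa> * ((p - 1) * w * W powr (p - 1)) * z powr p" using p pos by simp
    then show ?thesis by (simp add: Q_def algebra_simps)
  qed
  \<comment> \<open>The singular terms cancel and the four remaining errors are at most
    \<open>Q / 8\<close> each, so \<open>Q\<close> would be at most \<open>Q / 2\<close>.\<close>
  then show False using ineq E T1 T2 Qpos by linarith
qed

text \<open>Most errors need only a linear lower bound on \<open>A\<close>. The bounded part of the
  drift is linear in \<open>z\<close> and competes with a \<open>p\<close>-th power, so it is
  \<open>A powr (p - 1)\<close> that must be large, however close \<open>p\<close> is to 1.\<close>

lemma exists_absorption_constant:
  fixes p c1 k m :: real
  assumes "p > 1"
  obtains A where "A > 0" "A \<ge> 16 + 16 * c1 + 4 * k + 16 * k * p" "A powr (p - 1) \<ge> 64 * k * (1 + m)"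
proof
  define X where "X = \<bar>64 * k * (1 + m)\<bar> + 1"
  define A where "A = max 1 (max (16 + 16 * c1 + 4 * k + 16 * k * p) (X powr (1 / (p - 1))))"
  show "A > 0" "A \<ge> 16 + 16 * c1 + 4 * k + 16 * k * p" by (auto simp: A_def)
  have "X = (X powr (1 / (p - 1))) powr (p - 1)" using assms by (simp add: powr_powr X_def)
  also have "\<dots> \<le> A powr (p - 1)" using assms by (intro powr_mono2) (auto simp: A_def)
  finally show "A powr (p - 1) \<ge> 64 * k * (1 + m)" by (simp add: X_def)
qed

section \<open>The bound for the logarithmic gradient, and the return to \<open>u\<close>\<close>

lemma C21_onD:
  fixes u :: "real^'n::finite \<Rightarrow> real \<Rightarrow> real"
  assumes "C21_on Q u" and "(x, t) \<in> Q"
  shows "((\<lambda>s. u (x + s *\<^sub>R axis i 1) t) has_real_derivative partial i (\<lambda>y. u y t) x) (at 0)"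
    and "((\<lambda>s. partial i (\<lambda>y. u y t) (x + s *\<^sub>R axis i 1)) has_real_derivative
      partial i (partial i (\<lambda>y. u y t)) x) (at 0)"
    and "((\<lambda>s. u x s) has_real_derivative dt u x t) (at t)"
proof -
  have "(\<lambda>s. u (x + s *\<^sub>R axis i 1) t) differentiable (at 0)"
    "(\<lambda>s. partial i (\<lambda>y. u y t) (x + s *\<^sub>R axis i 1)) differentiable (at 0)"
    "(\<lambda>s. u x s) differentiable (at t)"
    using assms unfolding C21_on_def by fast+
  note this[folded DERIV_deriv_iff_real_differentiable]
  then show "((\<lambda>s. u (x + s *\<^sub>R axis i 1) t) has_real_derivative partial i (\<lambda>y. u y t) x) (at 0)"
    and "((\<lambda>s. partial i (\<lambda>y. u y t) (x + s *\<^sub>R axis i 1)) has_real_derivative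
      partial i (partial i (\<lambda>y. u y t)) x) (at 0)"
    and "((\<lambda>s. u x s) has_real_derivative dt u x t) (at t)"
    by (simp_all only: partial_def[of i "\<lambda>y. u y t" x] partial_def[of i "partial i (\<lambda>y. u y t)" x] dt_def)
qed

text \<open>At time \<open>t0\<close> the left-hand side is \<open>r\<close> times the cutoff times
  the absolute value of a component of the gradient of \<open>Z\<close>. If it exceeded
  \<open>A\<close>, the Bernstein inequality with \<open>N = A / r\<close> would give a point where
  the gradient is still large, which the absorption estimate excludes.\<close>

lemma local_log_gradient_bound:
  fixes u :: "real^'n::finite \<Rightarrow> real \<Rightarrow> real" and p R T M L r t0 A c :: real and k :: nat
  assumes p: "p > 1" and c: "c = (p - 1) / p" and R: "0 < r" "r < R" and t0: "0 < t0" "t0 < T"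
    and u: "C21_on (ball 0 R \<times> {0<..<T}) u"
    and eq: "\<And>x t. x \<in> ball 0 R \<Longrightarrow> t \<in> {0<..<T} \<Longrightarrow>
        dt u x t - laplacian (\<lambda>y. u y t) x = norm (grad (\<lambda>y. u y t) x) powr p"
    and M: "\<And>x t. x \<in> ball 0 R \<Longrightarrow> t \<in> {0<..<T} \<Longrightarrow> u x t < M"
    and L: "L > 0" "L powr p \<ge> r powr p * (1 / (2 * r\<^sup>2) + 1 / t0)"
    and k: "k \<ge> 2" "real k * (p - 1) \<ge> 1"
    and A: "A > 0" "A \<ge> 16 + 16 * (8 * (real k)\<^sup>2 + 2 * real CARD('n) * real k) + 4 * real k + 16 * real k * p"
      "A powr (p - 1) \<ge> 64 * real k * (1 + 1 / (p - 1))"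
    and x: "x \<in> ball 0 r"
  shows "r * cutoff_base r x ^ k * (log_profile_deriv c L (M - u x t0) * \<bar>partial j (\<lambda>y. u y t0) x\<bar>) \<le> A"
proof (rule ccontr)
  define g where "g = log_profile_deriv c L"
  define m where "m = 1 / (p - 1)"
  define \<kappa> where "\<kappa> = c powr (1 - p)"
  \<comment> \<open>Nothing is known at time 0, so the ramp starts halfway; its length
    \<open>t0 / 2\<close> is the origin of the 2 in \<open>2 / (t0 * \<theta>)\<close>.\<close>
  define \<tau> where "\<tau> = t0 / 2"
  define v where "v x t = M - u x t" for x t
  define Z where "Z x t = ln (v x t powr c + L)" for x t
  define Zi where "Zi i x t = - (g (v x t) * partial i (\<lambda>y. u y t) x)" for i x t
  \<comment> \<open>As functions of \<open>s = Z\<close>, with \<open>exp s = w + L\<close> and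
    \<open>exp s - L = w\<close>; the admissible range \<open>s > ln L\<close> is exactly
    \<open>w > 0\<close>.\<close>
  define \<alpha> where "\<alpha> s = 1 + m * exp s / (exp s - L)" for s
  define \<beta> where "\<beta> s = \<kappa> * ((exp s - L) * exp ((p - 1) * s))" for s
  define \<alpha>' where "\<alpha>' s = - (m * L * exp s / (exp s - L)\<^sup>2)" for s
  define \<beta>' where "\<beta>' s = \<kappa> * (exp s * exp ((p - 1) * s) + (exp s - L) * ((p - 1) * exp ((p - 1) * s)))" for s
  define Zii where "Zii i x t = - \<alpha> (Z x t) * (g (v x t))\<^sup>2 * (partial i (\<lambda>y. u y t) x)\<^sup>2
    - g (v x t) * partial i (partial i (\<lambda>y. u y t)) x" for i x t
  define Zt where "Zt x t = - (g (v x t) * dt u x t)" for x t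
  have c01: "0 < c" "c < 1" using p c by auto
  have m: "m > 0" "m = 1 / c - 1" using p by (auto simp: m_def c field_simps)
  have \<kappa>: "\<kappa> \<ge> 1"
    using powr_mono'[of "1 - p" 0 c] c01 p by (simp add: \<kappa>_def)
  have v: "v x t > 0" if "x \<in> ball 0 R" "t \<in> {0<..<T}" for x t
    using M[OF that] by (simp add: v_def)
  have W: "v x t powr c + L > 0" if "x \<in> ball 0 R" "t \<in> {0<..<T}" for x t
    using v[OF that] L by (simp add: add_pos_pos)
  have expZ: "exp (Z x t) = v x t powr c + L" if "x \<in> ball 0 R" "t \<in> {0<..<T}" for x t
    using W[OF that] by (simp add: Z_def)
  have Z_gt: "ln L < Z x t" if "x \<in> ball 0 R" "t \<in> {0<..<T}" for x t
    unfolding Z_def using v[OF that] L W[OF that] by (subst ln_less_cancel_iff) auto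
  have expL: "exp s - L > 0" if "ln L < s" for s
    using that L by (metis diff_gt_0_iff_gt exp_less_mono exp_ln)
  have norm_Zi: "norm (\<chi> i. Zi i x t) = g (v x t) * norm (grad (\<lambda>y. u y t) x)"
    if "x \<in> ball 0 R" "t \<in> {0<..<T}" for x t
  proof -
    have "(\<chi> i. Zi i x t) = (- g (v x t)) *\<^sub>R grad (\<lambda>y. u y t) x"
      by (simp add: vec_eq_iff Zi_def grad_def)
    then show ?thesis using log_profile_deriv_pos[OF v[OF that] L(1) c01(1)] by (simp add: g_def)
  qed
  have \<alpha>Z: "\<alpha> (Z x t) = 1 + (1 / c - 1) * (v x t powr c + L) / v x t powr c"
    if "x \<in> ball 0 R" "t \<in> {0<..<T}" for x t
    by (simp add: \<alpha>_def expZ[OF that] m)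
  interpret local_gradient_equation R T p Z Zt Zi Zii \<alpha> \<beta> \<alpha>' \<beta>' "ln L" r \<tau> t0
    "cutoff k r \<tau> t0" "cutoff_t k r \<tau> t0" "cutoff_i k r \<tau> t0" "cutoff_ii k r \<tau> t0"
  proof
    show "1 < p" "0 < r" "r < R" "0 < \<tau>" "\<tau> < t0" "t0 < T" using p R t0 by (auto simp: \<tau>_def)
    let ?Q = "ball (0::real^'n) R \<times> {0<..<T}"
    have cu: "continuous_on ?Q (\<lambda>q. u (fst q) (snd q))"
      and cui: "continuous_on ?Q (\<lambda>q. partial i (\<lambda>y. u y (snd q)) (fst q))" for i
      using u by (simp_all add: C21_on_def case_prod_beta)
    have vq: "v (fst q) (snd q) \<noteq> 0" "v (fst q) (snd q) powr c + L \<noteq> 0" if "q \<in> ?Q" for q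
      using v[of "fst q" "snd q"] W[of "fst q" "snd q"] that unfolding mem_Times_iff by fastforce+
    have cv: "continuous_on ?Q (\<lambda>q. v (fst q) (snd q) powr a)" for a
    proof (rule continuous_on_powr)
      show "continuous_on ?Q (\<lambda>q. v (fst q) (snd q))"
        unfolding v_def by (rule continuous_on_diff[OF continuous_on_const cu])
    qed (use vq in \<open>auto intro: continuous_on_const\<close>)
    have cW: "continuous_on ?Q (\<lambda>q. v (fst q) (snd q) powr c + L)"
      by (rule continuous_on_add[OF cv continuous_on_const])
    show "continuous_on ?Q (\<lambda>(x, t). Z x t)"
      unfolding Z_def case_prod_beta by (rule continuous_on_ln[OF cW]) (use vq(2) in blast)
    have "continuous_on ?Q (\<lambda>q. g (v (fst q) (snd q)))"
      unfolding g_def log_profile_deriv_def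
      by (rule continuous_on_divide[OF continuous_on_mult[OF continuous_on_const cv] cW]) (use vq(2) in blast)
    from continuous_on_minus[OF continuous_on_mult[OF this cui]]
    show "continuous_on ?Q (\<lambda>(x, t). Zi i x t)" for i
      unfolding Zi_def case_prod_beta .
    fix x :: "real^'n" and t :: real and i :: 'n
    assume xt: "x \<in> ball 0 R" "t \<in> {0<..<T}"
    then have "(x, t) \<in> ?Q" by simp
    note du = C21_onD[OF u this]
    have Dv: "((\<lambda>s. v (x + s *\<^sub>R axis i 1) t) has_real_derivative - partial i (\<lambda>y. u y t) x) (at 0)"
      unfolding v_def using DERIV_diff[OF DERIV_const du(1)] by simp
    have v0: "v (x + 0 *\<^sub>R axis i 1) t = v x t" by simp
    show "((\<lambda>s. Z (x + s *\<^sub>R axis i 1) t) has_real_derivative Zi i x t) (at 0)"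
    proof -
      have "((\<lambda>v. ln (v powr c + L)) has_real_derivative g (v x t)) (at (v (x + 0 *\<^sub>R axis i 1) t))"
        unfolding v0 g_def by (rule DERIV_log_profile[OF v[OF xt] L(1)])
      from DERIV_chain2[OF this Dv] show ?thesis by (simp only: Z_def Zi_def mult_minus_right)
    qed
    have gs: "(g has_real_derivative - (\<alpha> (Z x t) * (g (v x t))\<^sup>2)) (at (v (x + 0 *\<^sub>R axis i 1) t))"
      unfolding v0 g_def \<alpha>Z[OF xt] by (rule DERIV_log_profile_deriv[OF v[OF xt] L(1) c01(1)])
    have "((\<lambda>s. - (g (v (x + s *\<^sub>R axis i 1) t) * partial i (\<lambda>y. u y t) (x + s *\<^sub>R axis i 1)))
      has_real_derivative - (- (\<alpha> (Z x t) * (g (v x t))\<^sup>2) * - partial i (\<lambda>y. u y t) x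
        * partial i (\<lambda>y. u y t) (x + 0 *\<^sub>R axis i 1)
        + partial i (partial i (\<lambda>y. u y t)) x * g (v (x + 0 *\<^sub>R axis i 1) t))) (at 0)"
      by (intro DERIV_minus DERIV_mult DERIV_chain2[OF gs Dv] du(2))
    then show "((\<lambda>s. Zi i (x + s *\<^sub>R axis i 1) t) has_real_derivative Zii i x t) (at 0)"
      unfolding Zi_def Zii_def v0 by (rule DERIV_cong) (simp add: power2_eq_square mult_ac)
    have Dvt: "((\<lambda>s. v x s) has_real_derivative - dt u x t) (at t)"
      unfolding v_def using DERIV_diff[OF DERIV_const du(3)] by simp
    show "((\<lambda>s. Z x s) has_real_derivative Zt x t) (at t)"
      using DERIV_chain2[OF DERIV_log_profile[OF v[OF xt] L(1), of c] Dvt]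
      by (simp only: Z_def Zt_def g_def mult_minus_right)
    show "ln L < Z x t" by (rule Z_gt[OF xt])
    define N where "N = norm (grad (\<lambda>y. u y t) x)"
    have N2: "N\<^sup>2 = (\<Sum>i\<in>UNIV. (partial i (\<lambda>y. u y t) x)\<^sup>2)"
      by (simp add: N_def grad_def norm_vec_power2)
    have gp: "g (v x t) > 0" using log_profile_deriv_pos[OF v[OF xt] L(1) c01(1)] by (simp add: g_def)
    have "(\<Sum>i\<in>UNIV. Zii i x t) = - (\<alpha> (Z x t) * (g (v x t))\<^sup>2 * N\<^sup>2) - g (v x t) * laplacian (\<lambda>y. u y t) x"
      by (simp add: Zii_def N2 laplacian_def sum_subtractf sum_distrib_left sum_negf)
    then have "Zt x t - (\<Sum>i\<in>UNIV. Zii i x t) = \<alpha> (Z x t) * (g (v x t))\<^sup>2 * N\<^sup>2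
        - g (v x t) * (dt u x t - laplacian (\<lambda>y. u y t) x)"
      by (simp add: Zt_def algebra_simps)
    also have "\<dots> = \<alpha> (Z x t) * (g (v x t) * N)\<^sup>2 - g (v x t) * N powr p"
      by (simp add: eq[OF xt] N_def power_mult_distrib)
    also have "g (v x t) * N powr p = \<beta> (Z x t) * (g (v x t) * N) powr p"
    proof -
      have "exp ((p - 1) * Z x t) = (v x t powr c + L) powr (p - 1)"
        using W[OF xt] by (simp add: powr_def Z_def)
      then have "\<beta> (Z x t) * g (v x t) powr p = g (v x t)"
        using log_profile_deriv_powr[OF v[OF xt] L(1) p c] by (simp add: \<beta>_def expZ[OF xt] \<kappa>_def g_def)
      then show ?thesis using gp by (simp add: powr_mult N_def flip: mult.assoc)
    qed
    finally show "Zt x t - (\<Sum>i\<in>UNIV. Zii i x t)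
        = \<alpha> (Z x t) * (norm (\<chi> i. Zi i x t))\<^sup>2 - \<beta> (Z x t) * norm (\<chi> i. Zi i x t) powr p"
      by (simp only: norm_Zi[OF xt] N_def)
  next
    fix s assume s: "ln L < s"
    note e = expL[OF s]
    have "((\<lambda>s. 1 + m * exp s / (exp s - L)) has_real_derivative
       (m * exp s * (exp s - L) - m * exp s * exp s) / ((exp s - L) * (exp s - L))) (at s)"
      using e by (auto intro!: derivative_eq_intros)
    moreover have "(m * exp s * (exp s - L) - m * exp s * exp s) / ((exp s - L) * (exp s - L)) = \<alpha>' s"
      by (simp add: \<alpha>'_def power2_eq_square algebra_simps)
    ultimately show "(\<alpha> has_real_derivative \<alpha>' s) (at s)" unfolding \<alpha>_def[abs_def] by simp
    show "isCont \<alpha>' s" unfolding \<alpha>'_def[abs_def] using e by (intro continuous_intros) auto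
    show "(\<beta> has_real_derivative \<beta>' s) (at s)"
      unfolding \<beta>_def[abs_def] \<beta>'_def by (auto intro!: derivative_eq_intros simp: algebra_simps)
    show "isCont \<beta>' s" unfolding \<beta>'_def[abs_def] by (intro continuous_intros)
    show "0 \<le> \<alpha> s" using e m by (simp add: \<alpha>_def)
    show "0 \<le> \<beta> s" using e \<kappa> by (simp add: \<beta>_def)
  next
    fix x :: "real^'n" and t :: real
    { assume "x \<in> cball 0 r" "t \<in> {\<tau>..t0}"
      moreover have "norm x = r \<or> norm x < r" using \<open>x \<in> cball 0 r\<close> by auto
      ultimately show "0 \<le> cutoff k r \<tau> t0 x t"
        using cutoff_base_bounds(1)[of x r] t0 R k
        by (auto simp: cutoff_def \<tau>_def cutoff_base_def dot_square_norm) }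
    { assume "norm x = r \<or> t = \<tau>"
      then show "cutoff k r \<tau> t0 x t = 0"
        using R k by (auto simp: cutoff_def cutoff_base_def dot_square_norm) }
  qed (rule DERIV_cutoff continuous_on_cutoff)+
  assume contra: "\<not> r * cutoff_base r x ^ k * (log_profile_deriv c L (M - u x t0) * \<bar>partial j (\<lambda>y. u y t0) x\<bar>) \<le> A"
  \<comment> \<open>The direction of differentiation is oriented so that the directional derivative
    at \<open>(x, t0)\<close> is the absolute value of the component.\<close>
  define \<sigma> where "\<sigma> = (if Zi j x t0 \<ge> 0 then 1 else - 1 :: real)"
  have xR: "x \<in> ball 0 R" "t0 \<in> {0<..<T}" using x R t0 by auto
  have \<sigma>: "\<bar>\<sigma>\<bar> = 1" "\<sigma> * Zi j x t0 = g (v x t0) * \<bar>partial j (\<lambda>y. u y t0) x\<bar>"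
    using log_profile_deriv_pos[OF v[OF xR] L(1) c01(1)]
    by (auto simp: \<sigma>_def Zi_def g_def abs_if zero_le_mult_iff mult_le_0_iff)
  have "cutoff k r \<tau> t0 x t0 = cutoff_base r x ^ k" using t0 by (simp add: cutoff_def \<tau>_def)
  then have "A / r < cutoff k r \<tau> t0 x t0 * (\<sigma> * Zi j x t0)"
    using contra R unfolding \<sigma> by (simp add: g_def v_def divide_less_eq mult_ac)
  moreover have "x \<in> cball 0 r" "t0 \<in> {\<tau>..t0}" "0 < A / r" using x t0 A R by (auto simp: \<tau>_def)
  ultimately obtain y t where y: "y \<in> ball 0 r" and t: "t \<in> {\<tau><..t0}"
    and \<eta>: "cutoff k r \<tau> t0 y t > 0" and large: "A / r \<le> cutoff k r \<tau> t0 y t * (\<sigma> * Zi j y t)"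
    and ineq: "(\<Sum>i\<in>UNIV. cutoff_ii k r \<tau> t0 i y t) / cutoff k r \<tau> t0 y t
        - cutoff_t k r \<tau> t0 y t / cutoff k r \<tau> t0 y t
        - 2 * (eta_grad_norm y t)\<^sup>2 / (cutoff k r \<tau> t0 y t)\<^sup>2
      \<le> \<alpha>' (Z y t) * (grad_norm y t)\<^sup>2 - \<beta>' (Z y t) * grad_norm y t powr p
        + (2 * \<alpha> (Z y t) * grad_norm y t + p * \<beta> (Z y t) * grad_norm y t powr (p - 1))
          * (eta_grad_norm y t / cutoff k r \<tau> t0 y t)"
    using bernstein_inequality[of "A / r" \<sigma> x t0 j] \<sigma>(1) by blast
  have yT: "y \<in> ball 0 R" "t \<in> {0<..<T}" using y t R t0 by (auto simp: \<tau>_def)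
  define w where "w = v y t powr c"
  define \<phi> where "\<phi> = cutoff_base r y"
  define \<theta> where "\<theta> = (t - \<tau>) / (t0 - \<tau>)"
  define z where "z = grad_norm y t"
  have w: "w > 0" using v[OF yT] by (simp add: w_def)
  have eZ: "exp (Z y t) = w + L" "exp ((p - 1) * Z y t) = (w + L) powr (p - 1)"
    using W[OF yT] expZ[OF yT] by (simp_all add: w_def powr_def Z_def)
  have \<phi>: "0 < \<phi>" "\<phi> \<le> 1" using cutoff_base_bounds[of y r] y by (auto simp: \<phi>_def)
  have \<theta>: "0 < \<theta>" "\<theta> \<le> 1" using t t0 by (auto simp: \<theta>_def \<tau>_def divide_le_eq)
  have \<eta>_eq: "cutoff k r \<tau> t0 y t = \<phi> powr real k * \<theta>"
    using \<phi> by (simp add: cutoff_def \<phi>_def \<theta>_def powr_realpow)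
  \<comment> \<open>The component is replaced by the full gradient norm, the quantity that appears
    in the inequality at the maximum point.\<close>
  have "\<sigma> * Zi j y t \<le> \<bar>Zi j y t\<bar>" using \<sigma>(1) by (metis abs_ge_self abs_mult mult_1)
  also have "\<dots> \<le> z" unfolding z_def grad_norm_def
    using component_le_norm_cart[of "\<chi> i. Zi i y t" j] by simp
  finally have z: "\<sigma> * Zi j y t \<le> z" .
  have "A / r \<le> \<phi> powr real k * \<theta> * z"
    using large mult_left_mono[OF z less_imp_le[OF \<eta>]] unfolding \<eta>_eq by linarith
  then have large': "A \<le> r * (\<phi> powr real k * \<theta>) * z" using R by (simp add: divide_le_eq mult_ac)
  have z0: "z > 0"
    using large \<eta> A(1) R z by (smt (verit) divide_pos_pos mult_nonneg_nonpos)
  have t': "\<tau> < t" "\<tau> < t0" using t t0 by (auto simp: \<tau>_def)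
  have "2 / (t0 * \<theta>) = 1 / (t - \<tau>)"
    using t' t0 by (simp add: \<theta>_def \<tau>_def field_simps)
  with cutoff_log_derivative_bounds(2)[of y r \<tau> t t0 k] y t' k
  have low: "- (2 / (t0 * \<theta>) + (8 * (real k)\<^sup>2 + 2 * real CARD('n) * real k) / (r\<^sup>2 * \<phi>\<^sup>2))
      \<le> (\<Sum>i\<in>UNIV. cutoff_ii k r \<tau> t0 i y t) / cutoff k r \<tau> t0 y t
        - cutoff_t k r \<tau> t0 y t / cutoff k r \<tau> t0 y t
        - 2 * (eta_grad_norm y t)\<^sup>2 / (cutoff k r \<tau> t0 y t)\<^sup>2"
    by (simp add: \<phi>_def eta_grad_norm_def)
  have coeffs: "\<alpha> (Z y t) = 1 + m * (w + L) / w" "\<alpha>' (Z y t) = - (m * L * (w + L) / w\<^sup>2)"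
    "\<beta> (Z y t) = \<kappa> * (w * (w + L) powr (p - 1))"
    "\<beta>' (Z y t) = \<kappa> * ((w + L) powr p + (p - 1) * w * (w + L) powr (p - 1))"
    using w L by (simp_all add: \<alpha>_def \<alpha>'_def \<beta>_def \<beta>'_def eZ powr_diff)
  show False
  proof (rule bernstein_absorption[where p = p and m = m and k = "real k" and A = A
        and ?c1.0 = "8 * (real k)\<^sup>2 + 2 * real CARD('n) * real k" and r = r and ?t0.0 = t0 and L = L and w = w
        and W = "w + L" and \<kappa> = \<kappa> and \<phi> = \<phi> and \<theta> = \<theta> and z = z
        and G = "eta_grad_norm y t / cutoff k r \<tau> t0 y t"])
    show "eta_grad_norm y t / cutoff k r \<tau> t0 y t \<le> 2 * real k / (r * \<phi>)"
      using cutoff_log_derivative_bounds(1)[of y r \<tau> t t0 k] y t' k by (simp add: \<phi>_def eta_grad_norm_def)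
    show "0 \<le> eta_grad_norm y t / cutoff k r \<tau> t0 y t" using \<eta> by (simp add: eta_grad_norm_def)
    show "- (2 / (t0 * \<theta>) + (8 * (real k)\<^sup>2 + 2 * real CARD('n) * real k) / (r\<^sup>2 * \<phi>\<^sup>2))
      \<le> - (m * L * (w + L) / w\<^sup>2) * z\<^sup>2 - \<kappa> * ((w + L) powr p + (p - 1) * w * (w + L) powr (p - 1)) * z powr p
        + (2 * (1 + m * (w + L) / w) * z + p * (\<kappa> * (w * (w + L) powr (p - 1))) * z powr (p - 1))
          * (eta_grad_norm y t / cutoff k r \<tau> t0 y t)"
      using order_trans[OF low ineq] by (simp only: coeffs flip: z_def)
  qed (use p k A R t0 L w \<kappa> \<phi> \<theta> z0 large' in \<open>auto simp: m_def\<close>)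
qed

lemma exists_cutoff_exponent:
  fixes p :: real
  assumes "p > 1"
  obtains k :: nat where "k \<ge> 2" "real k * (p - 1) \<ge> 1"
proof
  define k where "k = max 2 (nat \<lceil>1 / (p - 1)\<rceil>)"
  show "k \<ge> 2" by (simp add: k_def)
  have "1 / (p - 1) \<le> real k" by (simp add: k_def) linarith
  then show "real k * (p - 1) \<ge> 1" using assms by (simp add: divide_le_eq)
qed

text \<open>Undoing the substitution produces the two terms of the claim: the reciprocal of
  \<open>log_profile_deriv\<close> is \<open>(v + v powr (1 / p) * L) / c\<close>, and
  \<open>L / R\<close> is \<open>S powr (1 / p)\<close>. Every time \<open>t\<close> serves as its
  own terminal time, and \<open>k\<close>, \<open>A\<close> are fixed before \<open>R\<close>,
  \<open>T\<close>, \<open>M\<close> and \<open>u\<close>. The strict bound by \<open>M\<close>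
  keeps \<open>v\<close> off the singularity of its negative powers.\<close>

lemma gradient_estimate_below_bound:
  fixes p :: real
  assumes p: "p > 1"
  shows "\<exists>C>0. \<forall>(R::real) (T::real) M (u :: real^'n::finite \<Rightarrow> real \<Rightarrow> real).
    R > 0 \<longrightarrow> C21_on (ball 0 R \<times> {0<..<T}) u \<longrightarrow>
    (\<forall>x\<in>ball 0 R. \<forall>t\<in>{0<..<T}.
        dt u x t - laplacian (\<lambda>y. u y t) x = norm (grad (\<lambda>y. u y t) x) powr p) \<longrightarrow>
    (\<forall>x\<in>ball 0 R. \<forall>t\<in>{0<..<T}. u x t < M) \<longrightarrow>
    (\<forall>x\<in>ball 0 (R/2). \<forall>t\<in>{0<..<T}.
       norm (grad (\<lambda>y. u y t) x) \<le>
         C * ((M - u x t) / R + ((M - u x t) / min (R^2) t) powr (1/p)))"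
proof -
  define c where "c = (p - 1) / p"
  have c: "0 < c" "1 - c = 1 / p" using p by (auto simp: c_def field_simps)
  obtain k :: nat where k: "k \<ge> 2" "real k * (p - 1) \<ge> 1" using exists_cutoff_exponent[OF p] .
  obtain A where A: "A > 0"
    "A \<ge> 16 + 16 * (8 * (real k)\<^sup>2 + 2 * real CARD('n) * real k) + 4 * real k + 16 * real k * p"
    "A powr (p - 1) \<ge> 64 * real k * (1 + 1 / (p - 1))"
    using exists_absorption_constant[OF p] .
  \<comment> \<open>The factor \<open>CARD('n)\<close> comes from summing components,
    \<open>9 / 5\<close> from the cutoff being at least \<open>5 / 9\<close> on the half ball, and
    \<open>4 / 3\<close> from \<open>R / r\<close>.\<close>
  define B where "B = real CARD('n) * (A * (9 / 5) ^ k * (4 / 3))"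
  have B: "B > 0" using A by (simp add: B_def)
  show ?thesis
  proof (intro exI[of _ "2 * B / c"] conjI allI impI ballI)
    show "0 < 2 * B / c" using B c by simp
    fix R T M :: real and u :: "real^'n \<Rightarrow> real \<Rightarrow> real" and x :: "real^'n" and t :: real
    assume R: "R > 0" and u: "C21_on (ball 0 R \<times> {0<..<T}) u"
      and eq: "\<forall>x\<in>ball 0 R. \<forall>t\<in>{0<..<T}.
        dt u x t - laplacian (\<lambda>y. u y t) x = norm (grad (\<lambda>y. u y t) x) powr p"
      and M: "\<forall>x\<in>ball 0 R. \<forall>t\<in>{0<..<T}. u x t < M"
      and x: "x \<in> ball 0 (R / 2)" and t: "t \<in> {0<..<T}"
    define v where "v = M - u x t"
    define S where "S = 1 / R\<^sup>2 + 1 / t"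
    define L where "L = R * S powr (1 / p)"
    \<comment> \<open>A radius strictly between \<open>R / 2\<close> and \<open>R\<close>; on the
      half ball the paraboloid is at least 1 - (2/3)^2 = 5/9.\<close>
    define r where "r = 3 / 4 * R"
    have t0: "0 < t" "t < T" using t by auto
    have S: "S > 0" using R t0 by (simp add: S_def add_pos_pos)
    have L: "L > 0" using R S by (simp add: L_def)
    have v: "v > 0" using M x t R by (auto simp: v_def)
    have r: "0 < r" "r < R" and xr: "x \<in> ball 0 r" using R x by (auto simp: r_def)
    have Lp: "L powr p \<ge> r powr p * (1 / (2 * r\<^sup>2) + 1 / t)"
    proof -
      have "1 / (2 * r\<^sup>2) \<le> 1 / R\<^sup>2" using R by (simp add: r_def field_simps power2_eq_square)
      then have "1 / (2 * r\<^sup>2) + 1 / t \<le> S" by (simp add: S_def)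
      moreover have "r powr p \<le> R powr p" using r p by (intro powr_mono2) auto
      ultimately have "r powr p * (1 / (2 * r\<^sup>2) + 1 / t) \<le> R powr p * S"
        using r t0 by (intro mult_mono) auto
      also have "\<dots> = L powr p" using R S p by (simp add: L_def powr_mult powr_powr)
      finally show ?thesis .
    qed
    define g where "g = log_profile_deriv c L v"
    have g: "g > 0" using log_profile_deriv_pos[OF v L c(1)] by (simp add: g_def)
    have \<phi>: "5 / 9 \<le> cutoff_base r x"
    proof -
      have "(norm x)\<^sup>2 \<le> (R / 2)\<^sup>2" using x by (intro power_mono) auto
      then show ?thesis using R
        by (simp add: cutoff_base_def dot_square_norm r_def field_simps power2_eq_square)
    qed
    have comp: "\<bar>partial j (\<lambda>y. u y t) x\<bar> \<le> A * (9 / 5) ^ k * (4 / 3) / (R * g)" for j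
    proof -
      have "r * cutoff_base r x ^ k * (g * \<bar>partial j (\<lambda>y. u y t) x\<bar>) \<le> A"
        unfolding g_def v_def using eq M
        by (intro local_log_gradient_bound[OF p c_def r t0 u _ _ L Lp k A xr]) auto
      moreover have "r * (5 / 9) ^ k * (g * \<bar>partial j (\<lambda>y. u y t) x\<bar>)
          \<le> r * cutoff_base r x ^ k * (g * \<bar>partial j (\<lambda>y. u y t) x\<bar>)"
        using r g \<phi> by (intro mult_right_mono mult_left_mono power_mono) auto
      ultimately have "(9 / 5) ^ k * (r * (5 / 9) ^ k * (g * \<bar>partial j (\<lambda>y. u y t) x\<bar>)) \<le> (9 / 5) ^ k * A"
        by (intro mult_left_mono) auto
      moreover have "(9 / 5) ^ k * (r * (5 / 9) ^ k * (g * \<bar>partial j (\<lambda>y. u y t) x\<bar>))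
          = ((9 / 5) * (5 / 9)) ^ k * (r * (g * \<bar>partial j (\<lambda>y. u y t) x\<bar>))"
        by (simp only: power_mult_distrib mult_ac)
      ultimately have "r * (g * \<bar>partial j (\<lambda>y. u y t) x\<bar>) \<le> (9 / 5) ^ k * A" by simp
      then show ?thesis using R g by (simp add: r_def field_simps)
    qed
    have "norm (grad (\<lambda>y. u y t) x) \<le> (\<Sum>j\<in>UNIV. \<bar>partial j (\<lambda>y. u y t) x\<bar>)"
      using norm_le_l1_cart[of "grad (\<lambda>y. u y t) x"] by (simp add: grad_def)
    also have "\<dots> \<le> (\<Sum>j\<in>(UNIV::'n set). A * (9 / 5) ^ k * (4 / 3) / (R * g))"
      by (intro sum_mono comp)
    also have "\<dots> = B / (R * g)" by (simp add: B_def)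
    also have "\<dots> = B / c * ((v + v powr (1 / p) * L) / R)"
    proof -
      have "v powr (c - 1) * (v + v powr (1 / p) * L) = v powr c + L"
        using v by (simp add: distrib_left flip: c(2) powr_add mult.assoc) (simp add: powr_diff)
      then have "(v powr c + L) / v powr (c - 1) = v + v powr (1 / p) * L"
        using v by (simp add: field_simps)
      moreover have "B / (R * g) = B / c * ((v powr c + L) / v powr (c - 1) / R)"
        by (simp add: g_def log_profile_deriv_def)
      ultimately show ?thesis by simp
    qed
    also have "\<dots> = B / c * (v / R + (v * S) powr (1 / p))"
      using R v S by (simp add: L_def powr_mult add_divide_distrib)
    also have "\<dots> \<le> B / c * (v / R + 2 * (v / min (R\<^sup>2) t) powr (1 / p))"
    proof -
      \<comment> \<open>The sum of the two scales is at most twice the larger one, and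
        \<open>2 powr (1 / p)\<close> is at most 2.\<close>
      have "1 / R\<^sup>2 \<le> 1 / min (R\<^sup>2) t" "1 / t \<le> 1 / min (R\<^sup>2) t"
        using R t0 by (auto intro!: divide_left_mono)
      then have "v * S \<le> v * (2 * (1 / min (R\<^sup>2) t))" unfolding S_def using v by (intro mult_left_mono) auto
      then have "(v * S) powr (1 / p) \<le> (2 * (v / min (R\<^sup>2) t)) powr (1 / p)"
        using v S p by (intro powr_mono2) (auto simp: mult_ac)
      also have "\<dots> = 2 powr (1 / p) * (v / min (R\<^sup>2) t) powr (1 / p)"
        by (rule powr_mult)
      also have "\<dots> \<le> 2 * (v / min (R\<^sup>2) t) powr (1 / p)"
        using powr_mono[of "1 / p" 1 "2::real"] p by (intro mult_right_mono) auto
      finally show ?thesis using B c by (intro mult_left_mono) auto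
    qed
    also have "\<dots> \<le> B / c * (2 * (v / R) + 2 * (v / min (R\<^sup>2) t) powr (1 / p))"
    proof -
      have "0 \<le> v / R" using v R by simp
      then have "v / R \<le> 2 * (v / R)" by linarith
      then show ?thesis using B c by (intro mult_left_mono add_right_mono) auto
    qed
    finally show "norm (grad (\<lambda>y. u y t) x) \<le>
         2 * B / c * ((M - u x t) / R + ((M - u x t) / min (R^2) t) powr (1/p))"
      by (simp add: v_def distrib_left mult_ac)
  qed
qed

theorem theorem2p8:
  fixes p :: real
  assumes "p > 1"
  shows "\<exists>C>0. \<forall>(R::real) (T::real) (u :: real^'n::finite \<Rightarrow> real \<Rightarrow> real).
    R > 0 \<longrightarrow> T > 0 \<longrightarrow>
    C21_on (ball 0 R \<times> {0<..<T}) u \<longrightarrow>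
    (\<forall>x\<in>ball 0 R. \<forall>t\<in>{0<..<T}.
        dt u x t - laplacian (\<lambda>y. u y t) x = norm (grad (\<lambda>y. u y t) x) powr p) \<longrightarrow>
    bdd_above ((\<lambda>(x,t). u x t) ` (ball 0 R \<times> {0<..<T})) \<longrightarrow>
    (let M = Sup ((\<lambda>(x,t). u x t) ` (ball 0 R \<times> {0<..<T})) in
     \<forall>x\<in>ball 0 (R/2). \<forall>t\<in>{0<..<T}.
       norm (grad (\<lambda>y. u y t) x) \<le>
         C * ((M - u x t) / R + ((M - u x t) / min (R^2) t) powr (1/p)))"
proof -
  obtain C where C: "C > 0" and est: "\<And>(R::real) T M (u :: real^'n \<Rightarrow> real \<Rightarrow> real) x t.
    R > 0 \<Longrightarrow> C21_on (ball 0 R \<times> {0<..<T}) u \<Longrightarrow>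
    \<forall>x\<in>ball 0 R. \<forall>t\<in>{0<..<T}.
        dt u x t - laplacian (\<lambda>y. u y t) x = norm (grad (\<lambda>y. u y t) x) powr p \<Longrightarrow>
    \<forall>x\<in>ball 0 R. \<forall>t\<in>{0<..<T}. u x t < M \<Longrightarrow> x \<in> ball 0 (R/2) \<Longrightarrow> t \<in> {0<..<T} \<Longrightarrow>
       norm (grad (\<lambda>y. u y t) x) \<le>
         C * ((M - u x t) / R + ((M - u x t) / min (R^2) t) powr (1/p))"
    using gradient_estimate_below_bound[OF assms, where 'n = 'n] by metis
  show ?thesis unfolding Let_def
  proof (intro exI[of _ C] conjI allI impI ballI C)
    fix R T :: real and u :: "real^'n \<Rightarrow> real \<Rightarrow> real" and x :: "real^'n" and t :: real
    let ?V = "(\<lambda>(x,t). u x t) ` (ball 0 R \<times> {0<..<T})"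
    assume R: "R > 0" and u: "C21_on (ball 0 R \<times> {0<..<T}) u"
      and eq: "\<forall>x\<in>ball 0 R. \<forall>t\<in>{0<..<T}.
        dt u x t - laplacian (\<lambda>y. u y t) x = norm (grad (\<lambda>y. u y t) x) powr p"
      and bdd: "bdd_above ?V" and x: "x \<in> ball 0 (R/2)" and t: "t \<in> {0<..<T}"
    have le: "u y s \<le> Sup ?V" if "y \<in> ball 0 R" "s \<in> {0<..<T}" for y s
      using that by (intro cSup_upper[OF _ bdd]) (auto intro: rev_image_eqI[of "(y, s)"])
    have d: "0 \<le> Sup ?V - u x t" using le[of x t] x t R by auto
    \<comment> \<open>The supremum may be attained, so it is raised by \<open>1 / (n + 1)\<close> to
      obtain a strict bound; \<open>C\<close> does not depend on that bound.\<close>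
    have bound: "norm (grad (\<lambda>y. u y t) x) \<le> C * ((Sup ?V + inverse (real (Suc n)) - u x t) / R
        + ((Sup ?V + inverse (real (Suc n)) - u x t) / min (R^2) t) powr (1/p))" for n
    proof (rule est[OF R u eq _ x t], intro ballI)
      fix y :: "real^'n" and s assume "y \<in> ball 0 R" "s \<in> {0<..<T}"
      from le[OF this] show "u y s < Sup ?V + inverse (real (Suc n))"
        by (rule order_le_less_trans) simp
    qed
    have lim: "(\<lambda>n. C * ((Sup ?V + inverse (real (Suc n)) - u x t) / R
        + ((Sup ?V + inverse (real (Suc n)) - u x t) / min (R^2) t) powr (1/p)))
      \<longlonglongrightarrow> C * ((Sup ?V + 0 - u x t) / R + ((Sup ?V + 0 - u x t) / min (R^2) t) powr (1/p))"
      \<comment> \<open>The limiting base of the power may be 0; the exponent \<open>1 / p\<close>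
        is positive and \<open>d\<close> makes the bases nonnegative, so the power is continuous
        there.\<close>
      using R t assms d
      by (intro tendsto_mult tendsto_add tendsto_divide tendsto_diff tendsto_powr' tendsto_const
          LIMSEQ_inverse_real_of_nat) (auto simp: min_def)
    have "norm (grad (\<lambda>y. u y t) x)
        \<le> C * ((Sup ?V + 0 - u x t) / R + ((Sup ?V + 0 - u x t) / min (R^2) t) powr (1/p))"
      by (rule LIMSEQ_le_const[OF lim]) (use bound in blast)
    then show "norm (grad (\<lambda>y. u y t) x) \<le>
         C * ((Sup ?V - u x t) / R + ((Sup ?V - u x t) / min (R^2) t) powr (1/p))"
      by (simp only: add_0_right)
  qed
qed

end
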